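(* Let $G_\bullet$ be a finitely generated $\mathrm{FI}$-graph such that $G_n$ is not bipartite for all sufficiently large $n$. Then the weighted walk on $G_n$ has mixing time which is constant in $n$: for every $\varepsilon>0$ there exist $T$ and $N$ such that for all $n>N$ the mixing time $t_{\mathrm{mix}}(\varepsilon)$ of the weighted walk on $G_n$ is at most $T$.
   Context: $\mathrm{FI}$ denotes the category of the sets $[n]=\{1,\dots,n\}$ and injections. An $\mathrm{FI}$-graph $G_\bullet$ is a functor from $\mathrm{FI}$ to graphs (finite vertex set, edges are $2$-subsets of vertices or loops) and graph homomorphisms; $G_n$ is its value on $[n]$, and the symmetric group $\mathfrak{S}_n$ acts on $G_n$ by graph automorphisms. It is finitely generated if for some $d$ and all $n\ge d$ every vertex of $G_{n+1}$ is in the image of $G(f)$ for some injection $f:[n]\hookrightarrow[n+1]$. All graphs are assumed connected. An edge orbit of $G_n$ is an $\mathfrak{S}_n$-orbit of edges. The weighted walk on $G_n$: from the current vertex $v$, choose uniformly at random one of the edge orbits that contain an edge incident to $v$, then choose uniformly at random an edge incident to $v$ from that orbit, and move along it. For an irreducible aperiodic Markov chain with stationary distribution $\pi$, $t_{\mathrm{mix}}(\varepsilon)$ is the smallest $t$ such that from every starting state the distribution after $t$ steps is within total variation distance $\varepsilon$ of $\pi$ (total variation distance between $\mu,\nu$ is $\frac12\sum_x|\mu(x)-\nu(x)|$). *)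

theory Defs
  imports "HOL-Probability.Probability" "HOL-Library.Extended_Nat"
begin

section \<open>Graphs\<close>

text \<open>A graph is a vertex set together with a set of edges, each edge being a 2-subset
  \<open>{u, v}\<close> or a loop, which is represented by the singleton \<open>{u}\<close>.\<close>

definition finite_graph :: "'v set \<Rightarrow> 'v set set \<Rightarrow> bool" where
  "finite_graph V E \<longleftrightarrow> finite V \<and> (\<forall>e\<in>E. \<exists>u\<in>V. \<exists>v\<in>V. e = {u, v})"

definition graph_hom ::
  "'v set \<Rightarrow> 'v set set \<Rightarrow> 'w set \<Rightarrow> 'w set set \<Rightarrow> ('v \<Rightarrow> 'w) \<Rightarrow> bool" where
  "graph_hom V E V' E' h \<longleftrightarrow> (\<forall>v\<in>V. h v \<in> V') \<and> (\<forall>e\<in>E. h ` e \<in> E')"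

text \<open>The empty graph counts as connected, so that an FI-graph may have no vertices
  in small degrees.\<close>

definition graph_connected :: "'v set \<Rightarrow> 'v set set \<Rightarrow> bool" where
  "graph_connected V E \<longleftrightarrow> (\<forall>u\<in>V. \<forall>v\<in>V. (u, v) \<in> {(x, y). {x, y} \<in> E}\<^sup>*)"

text \<open>As \<open>A\<close> and \<open>B\<close> are disjoint, a graph with a loop is not bipartite.\<close>

definition graph_bipartite :: "'v set \<Rightarrow> 'v set set \<Rightarrow> bool" where
  "graph_bipartite V E \<longleftrightarrow>
     (\<exists>A B. A \<union> B = V \<and> A \<inter> B = {} \<and> (\<forall>e\<in>E. \<exists>a\<in>A. \<exists>b\<in>B. e = {a, b}))"


section \<open>FI-graphs\<close>

text \<open>The FI-morphisms from \<open>[m]\<close> to \<open>[n]\<close>, where \<open>[n] = {1..n}\<close>. They are extensional, so that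
  each injection is represented by exactly one function; \<open>FI_hom n n\<close> is the symmetric group.\<close>

definition FI_hom :: "nat \<Rightarrow> nat \<Rightarrow> (nat \<Rightarrow> nat) set" where
  "FI_hom m n = {f \<in> {1..m} \<rightarrow>\<^sub>E {1..n}. inj_on f {1..m}}"

text \<open>A functor from FI to graphs: \<open>G\<^sub>n\<close> has vertices \<open>V n\<close> and edges \<open>E n\<close>, and \<open>F m n f\<close> is the
  vertex map of \<open>G(f)\<close> for \<open>f : [m] \<rightarrow> [n]\<close>. Its values outside \<open>V m\<close> are irrelevant.\<close>

locale FI_graph =
  fixes V :: "nat \<Rightarrow> 'v set"
    and E :: "nat \<Rightarrow> 'v set set"
    and F :: "nat \<Rightarrow> nat \<Rightarrow> (nat \<Rightarrow> nat) \<Rightarrow> 'v \<Rightarrow> 'v"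
  assumes graph: "finite_graph (V n) (E n)"
    and hom: "f \<in> FI_hom m n \<Longrightarrow> graph_hom (V m) (E m) (V n) (E n) (F m n f)"
    and map_id: "v \<in> V n \<Longrightarrow> F n n (restrict id {1..n}) v = v"
    and map_compose: "f \<in> FI_hom l m \<Longrightarrow> g \<in> FI_hom m n \<Longrightarrow> v \<in> V l \<Longrightarrow>
      F l n (compose {1..l} g f) v = F m n g (F l m f v)"

definition finitely_generated ::
  "(nat \<Rightarrow> 'v set) \<Rightarrow> (nat \<Rightarrow> nat \<Rightarrow> (nat \<Rightarrow> nat) \<Rightarrow> 'v \<Rightarrow> 'v) \<Rightarrow> bool" where
  "finitely_generated V F \<longleftrightarrow>
     (\<exists>d. \<forall>n\<ge>d. \<forall>v\<in>V (n + 1). \<exists>f\<in>FI_hom n (n + 1). v \<in> F n (n + 1) f ` V n)"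

definition edge_orbits ::
  "(nat \<Rightarrow> 'v set set) \<Rightarrow> (nat \<Rightarrow> nat \<Rightarrow> (nat \<Rightarrow> nat) \<Rightarrow> 'v \<Rightarrow> 'v) \<Rightarrow> nat \<Rightarrow> 'v set set set" where
  "edge_orbits E F n = (\<lambda>e. (\<lambda>\<sigma>. F n n \<sigma> ` e) ` FI_hom n n) ` E n"


section \<open>The weighted walk\<close>

text \<open>The one-step distribution from \<open>v\<close>. For an edge \<open>e\<close> incident to \<open>v\<close>, the vertex
  \<open>THE w. e = {v, w}\<close> is its other endpoint, or \<open>v\<close> itself if \<open>e\<close> is a loop. The kernel is
  meaningful only at vertices having an incident edge, since \<open>pmf_of_set {}\<close> is unspecified.\<close>

definition weighted_walk ::
  "(nat \<Rightarrow> 'v set set) \<Rightarrow> (nat \<Rightarrow> nat \<Rightarrow> (nat \<Rightarrow> nat) \<Rightarrow> 'v \<Rightarrow> 'v) \<Rightarrow> nat \<Rightarrow> 'v \<Rightarrow> 'v pmf" where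
  "weighted_walk E F n v =
     bind_pmf (pmf_of_set {Orb \<in> edge_orbits E F n. \<exists>e\<in>Orb. v \<in> e}) (\<lambda>Orb.
     bind_pmf (pmf_of_set {e \<in> Orb. v \<in> e}) (\<lambda>e.
     return_pmf (THE w. e = {v, w})))"


section \<open>Mixing times\<close>

definition step_dist :: "('s \<Rightarrow> 's pmf) \<Rightarrow> nat \<Rightarrow> 's \<Rightarrow> 's pmf" where
  "step_dist K t x = ((\<lambda>\<mu>. bind_pmf \<mu> K) ^^ t) (return_pmf x)"

definition tv_dist :: "'s set \<Rightarrow> 's pmf \<Rightarrow> 's pmf \<Rightarrow> real" where
  "tv_dist S \<mu> \<nu> = (1 / 2) * (\<Sum>x\<in>S. \<bar>pmf \<mu> x - pmf \<nu> x\<bar>)"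

definition stationary :: "'s set \<Rightarrow> ('s \<Rightarrow> 's pmf) \<Rightarrow> 's pmf \<Rightarrow> bool" where
  "stationary S K \<pi> \<longleftrightarrow> set_pmf \<pi> \<subseteq> S \<and> bind_pmf \<pi> K = \<pi>"

text \<open>The stationary distribution is unique when the chain \<open>K\<close> is irreducible on the finite
  state space \<open>S\<close>; the definite description is meaningful only then.\<close>

definition stationary_dist :: "'s set \<Rightarrow> ('s \<Rightarrow> 's pmf) \<Rightarrow> 's pmf" where
  "stationary_dist S K = (THE \<pi>. stationary S K \<pi>)"

text \<open>The least \<open>t\<close>, taken in \<open>enat\<close> so that it is \<open>\<infinity>\<close> if there is no such \<open>t\<close>.\<close>

definition mixing_time :: "'s set \<Rightarrow> ('s \<Rightarrow> 's pmf) \<Rightarrow> real \<Rightarrow> enat" where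
  "mixing_time S K \<epsilon> =
     Inf {enat t | t. \<forall>x\<in>S. tv_dist S (step_dist K t x) (stationary_dist S K) \<le> \<epsilon>}"

end

theory Submission
  imports Defs "HOL-Combinatorics.Permutations"
begin

text \<open>
  Every vertex of \<open>G\<^sub>n\<close> is the image of a vertex of \<open>G\<^sub>d\<close>, so its stabilizer contains all
  permutations fixing some \<open>d\<close> points, and the number of orbits of pairs of vertices is bounded by
  a constant \<open>R\<close>. Two consequences: there are at most \<open>R\<close> edge orbits, and, as \<open>G\<^sub>n\<close> is connected
  and not bipartite, any two vertices are joined by a walk of length exactly \<open>2 * R\<close>.

  For large \<open>n\<close> each vertex \<open>v\<close> has a smallest support \<open>M\<close>, and the permutations fixing \<open>M\<close>
  pointwise have bounded index in the stabilizer of \<open>v\<close>. Hence one step of the walk from \<open>v\<close>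
  dominates, up to a constant factor, the law of \<open>g w\<close>, where \<open>w\<close> is any neighbour of \<open>v\<close> and \<open>g\<close>
  is uniform among the permutations fixing \<open>M\<close>. The product of independent uniform permutations
  fixing \<open>A\<close> and \<open>B\<close> is uniform among those fixing \<open>A \<inter> B\<close> up to an error of order \<open>1 / n\<close>.
  Following a walk of length \<open>2 * R\<close> from \<open>x\<close> to a vertex \<open>y\<close> whose support is disjoint from that
  of \<open>x\<close>, one obtains a constant times the uniform law on the orbit of \<open>y\<close>, up to \<open>O(1 / n)\<close>. This
  law does not depend on \<open>x\<close>, so \<open>2 * R\<close> steps contract oscillations by a constant factor.
\<close>

section \<open>Mixing times of contracting chains\<close>

lemma step_dist_0: "step_dist K 0 x = return_pmf x"
  by (simp add: step_dist_def)

lemma step_dist_Suc: "step_dist K (Suc t) x = bind_pmf (step_dist K t x) K"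
  by (simp add: step_dist_def)

lemma step_dist_add: "step_dist K (s + r) x = bind_pmf (step_dist K s x) (step_dist K r)"
  by (induction r) (simp_all add: step_dist_0 step_dist_Suc bind_return_pmf' bind_assoc_pmf)

locale finite_chain =
  fixes S :: "'s set" and K :: "'s \<Rightarrow> 's pmf"
  assumes finite_S: "finite S" and S_nonempty: "S \<noteq> {}"
    and closed: "x \<in> S \<Longrightarrow> set_pmf (K x) \<subseteq> S"
begin

lemma set_step_dist: "x \<in> S \<Longrightarrow> set_pmf (step_dist K t x) \<subseteq> S"
  using closed by (induction t) (force simp: step_dist_0 step_dist_Suc)+

lemma expectation_eq_sum:
  fixes f :: "'s \<Rightarrow> real"
  assumes "set_pmf p \<subseteq> S"
  shows "measure_pmf.expectation p f = (\<Sum>x\<in>S. pmf p x * f x)"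
  using assms by (subst integral_measure_pmf[OF finite_S]) auto

lemma sum_pmf_S: "set_pmf p \<subseteq> S \<Longrightarrow> (\<Sum>x\<in>S. pmf p x) = 1"
  using finite_S by (simp add: sum_pmf_eq_1)

lemma expectation_bind:
  fixes f :: "'s \<Rightarrow> real"
  assumes "set_pmf p \<subseteq> S" "\<And>x. x \<in> S \<Longrightarrow> set_pmf (Q x) \<subseteq> S"
  shows "measure_pmf.expectation (bind_pmf p Q) f =
    measure_pmf.expectation p (\<lambda>x. measure_pmf.expectation (Q x) f)"
  using assms finite_S finite_subset[OF _ finite_S]
  by (subst pmf_expectation_bind[of S]) (auto simp: expectation_eq_sum)

lemma expectation_step_add:
  fixes f :: "'s \<Rightarrow> real"
  assumes "x \<in> S"
  shows "measure_pmf.expectation (step_dist K (s + r) x) f =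
    measure_pmf.expectation (step_dist K s x) (\<lambda>z. measure_pmf.expectation (step_dist K r z) f)"
  unfolding step_dist_add using assms set_step_dist by (intro expectation_bind) auto

lemma expectation_bounds:
  fixes f :: "'s \<Rightarrow> real"
  assumes "set_pmf p \<subseteq> S" "\<And>x. x \<in> S \<Longrightarrow> a \<le> f x" "\<And>x. x \<in> S \<Longrightarrow> f x \<le> b"
  shows "a \<le> measure_pmf.expectation p f" "measure_pmf.expectation p f \<le> b"
proof -
  have "(\<Sum>x\<in>S. pmf p x * a) \<le> (\<Sum>x\<in>S. pmf p x * f x)"
    "(\<Sum>x\<in>S. pmf p x * f x) \<le> (\<Sum>x\<in>S. pmf p x * b)"
    using assms by (auto intro!: sum_mono mult_left_mono)
  then show "a \<le> measure_pmf.expectation p f" "measure_pmf.expectation p f \<le> b"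
    using sum_pmf_S[OF assms(1)] expectation_eq_sum[OF assms(1), of f]
    by (simp_all flip: sum_distrib_right)
qed

lemma stationary_step: "stationary S K \<pi> \<Longrightarrow> bind_pmf \<pi> (step_dist K t) = \<pi>"
proof (induction t)
  case 0
  then show ?case by (simp add: step_dist_0[abs_def] bind_return_pmf')
next
  case (Suc t)
  have "bind_pmf \<pi> (step_dist K (Suc t)) = bind_pmf (bind_pmf \<pi> (step_dist K t)) K"
    by (simp add: step_dist_Suc[abs_def] bind_assoc_pmf)
  with Suc show ?case by (simp add: stationary_def)
qed

end

text \<open>The assumption is the Dobrushin condition in dual form: testing against functions with
  values in \<open>[0, 1]\<close> says that the \<open>t\<close>-step laws from any two states are
  at total variation distance at most \<open>1 - \<delta>\<close>.\<close>

locale contracting_chain = finite_chain +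
  fixes t :: nat and \<delta> :: real
  assumes \<delta>: "0 < \<delta>" "\<delta> < 1"
    and contracting: "(\<And>z. 0 \<le> \<phi> z) \<Longrightarrow> (\<And>z. \<phi> z \<le> 1) \<Longrightarrow> x \<in> S \<Longrightarrow> y \<in> S \<Longrightarrow>
      measure_pmf.expectation (step_dist K t x) \<phi> -
      measure_pmf.expectation (step_dist K t y) \<phi> \<le> 1 - \<delta>"
begin

text \<open>Subtracting the minimum over \<open>S\<close> and dividing by \<open>D\<close> turns
  \<open>\<phi>\<close> into a test function with values in \<open>[0, 1]\<close>, and expectations
  transform in the same affine way.\<close>

lemma contracting_osc:
  fixes \<phi> :: "'a \<Rightarrow> real"
  assumes D: "0 < D" and osc: "\<And>x y. x \<in> S \<Longrightarrow> y \<in> S \<Longrightarrow> \<phi> x - \<phi> y \<le> D"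
    and xy: "x \<in> S" "y \<in> S"
  shows "measure_pmf.expectation (step_dist K t x) \<phi> -
      measure_pmf.expectation (step_dist K t y) \<phi> \<le> (1 - \<delta>) * D"
proof -
  define m where "m = Min (\<phi> ` S)"
  have "m \<in> \<phi> ` S" unfolding m_def using finite_S S_nonempty by (intro Min_in) auto
  then obtain z where z: "z \<in> S" "m = \<phi> z" by auto
  have m_le: "m \<le> \<phi> x" if "x \<in> S" for x
    unfolding m_def using finite_S that by simp
  \<comment> \<open>The value 0 outside \<open>S\<close> is there because \<open>contracting\<close>
    asks for bounds at every point.\<close>
  define \<psi> where "\<psi> x = (if x \<in> S then (\<phi> x - m) / D else 0)" for x
  have \<psi>: "0 \<le> \<psi> x" "\<psi> x \<le> 1" for x
    using D m_le osc[OF _ z(1)] z(2) by (auto simp: \<psi>_def divide_simps)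
  have E: "measure_pmf.expectation p \<phi> = m + D * measure_pmf.expectation p \<psi>"
    if "set_pmf p \<subseteq> S" for p
  proof -
    have "(\<Sum>x\<in>S. pmf p x * \<phi> x) = (\<Sum>x\<in>S. pmf p x * m + D * (pmf p x * \<psi> x))"
      using D by (intro sum.cong) (auto simp: \<psi>_def field_simps)
    also have "\<dots> = m + D * (\<Sum>x\<in>S. pmf p x * \<psi> x)"
      using sum_pmf_S[OF that] by (simp add: sum.distrib flip: sum_distrib_left sum_distrib_right)
    finally show ?thesis by (simp add: expectation_eq_sum[OF that])
  qed
  show ?thesis
    using contracting[OF \<psi> xy] D by (simp add: E set_step_dist xy flip: right_diff_distrib)
qed

text \<open>The first \<open>t\<close> steps are tested against the expectation over the remaining
  \<open>m * t\<close> steps, a function whose oscillation on \<open>S\<close> is at most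
  \<open>(1 - \<delta>) ^ m\<close> by induction.\<close>

lemma iterated_contraction:
  fixes \<phi> :: "'a \<Rightarrow> real"
  assumes "\<And>z. z \<in> S \<Longrightarrow> 0 \<le> \<phi> z" "\<And>z. z \<in> S \<Longrightarrow> \<phi> z \<le> 1" "x \<in> S" "y \<in> S"
  shows "measure_pmf.expectation (step_dist K (m * t) x) \<phi> -
      measure_pmf.expectation (step_dist K (m * t) y) \<phi> \<le> (1 - \<delta>) ^ m"
  using assms(3,4)
proof (induction m arbitrary: x y)
  case 0
  then show ?case using assms(2)[of x] assms(1)[of y] by (simp add: step_dist_0)
next
  case (Suc m)
  have "measure_pmf.expectation (step_dist K t x)
         (\<lambda>z. measure_pmf.expectation (step_dist K (m * t) z) \<phi>) -
      measure_pmf.expectation (step_dist K t y)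
         (\<lambda>z. measure_pmf.expectation (step_dist K (m * t) z) \<phi>) \<le> (1 - \<delta>) * (1 - \<delta>) ^ m"
    using Suc \<delta> by (intro contracting_osc) auto
  then show ?case
    using Suc by (simp add: expectation_step_add)
qed

text \<open>Average of \<open>iterated_contraction\<close> over a second starting state with law
  \<open>\<nu>\<close>. Taking \<open>\<nu>\<close> stationary compares with equilibrium; taking
  \<open>\<nu>\<close> to be an \<open>r\<close>-step law compares two times of the same
  chain.\<close>

lemma stationary_close:
  fixes \<phi> :: "'a \<Rightarrow> real"
  assumes "\<And>z. z \<in> S \<Longrightarrow> 0 \<le> \<phi> z" "\<And>z. z \<in> S \<Longrightarrow> \<phi> z \<le> 1" "x \<in> S" "set_pmf \<nu> \<subseteq> S"
  shows "\<bar>measure_pmf.expectation (step_dist K (m * t) x) \<phi> -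
      measure_pmf.expectation (bind_pmf \<nu> (step_dist K (m * t))) \<phi>\<bar> \<le> (1 - \<delta>) ^ m"
proof -
  let ?P = "\<lambda>z. measure_pmf.expectation (step_dist K (m * t) z) \<phi>"
  have "?P x - (1 - \<delta>) ^ m \<le> ?P z" "?P z \<le> ?P x + (1 - \<delta>) ^ m" if "z \<in> S" for z
    using iterated_contraction[of \<phi>, OF assms(1,2) that assms(3), of m]
      iterated_contraction[of \<phi>, OF assms(1,2) assms(3) that, of m] by linarith+
  from expectation_bounds[of \<nu> _ ?P, OF assms(4) this] assms(4) show ?thesis
    by (simp add: expectation_bind set_step_dist abs_le_iff)
qed

lemma power_tendsto_0: "(\<lambda>m. (1 - \<delta>) ^ m) \<longlonglongrightarrow> 0"
  using \<delta> by (intro LIMSEQ_realpow_zero) auto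

text \<open>The laws after \<open>m * t\<close> steps from one fixed state come arbitrarily close to
  either stationary law.\<close>

lemma stationary_unique:
  assumes "stationary S K \<mu>" "stationary S K \<nu>"
  shows "\<mu> = \<nu>"
proof (rule pmf_eqI)
  fix y
  obtain x where x: "x \<in> S" using S_nonempty by auto
  have sub: "set_pmf \<mu> \<subseteq> S" "set_pmf \<nu> \<subseteq> S" using assms by (auto simp: stationary_def)
  have E: "measure_pmf.expectation p (indicator {y} :: 'a \<Rightarrow> real) = pmf p y" for p :: "'a pmf"
    by (simp add: pmf.rep_eq)
  have "\<bar>pmf \<mu> y - pmf \<nu> y\<bar> \<le> 2 * (1 - \<delta>) ^ m" for m
  proof -
    have "\<bar>measure_pmf.expectation (step_dist K (m * t) x) (indicator {y}) - pmf \<rho> y\<bar> \<le> (1 - \<delta>) ^ m"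
      if "stationary S K \<rho>" for \<rho>
      using stationary_close[of "indicator {y}" x \<rho> m] x that
      unfolding stationary_step[OF that] E by (simp add: stationary_def)
    from this[OF assms(1)] this[OF assms(2)] show ?thesis by linarith
  qed
  moreover have "(\<lambda>m. 2 * (1 - \<delta>) ^ m) \<longlonglongrightarrow> 2 * 0"
    by (intro tendsto_intros power_tendsto_0)
  ultimately have "\<bar>pmf \<mu> y - pmf \<nu> y\<bar> \<le> 2 * 0"
    by (intro LIMSEQ_le_const[where X="\<lambda>m. 2 * (1 - \<delta>) ^ m"]) blast+
  then show "pmf \<mu> y = pmf \<nu> y" by simp
qed

text \<open>The laws from a fixed state form a Cauchy sequence, since running \<open>r\<close> steps
  first only averages the starting state. The limit is invariant by passing to the limit in the
  one-step recursion.\<close>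

lemma stationary_exists: "\<exists>\<pi>. stationary S K \<pi>"
proof -
  obtain x where x: "x \<in> S" using S_nonempty by auto
  let ?p = "\<lambda>s y. pmf (step_dist K s x) y"
  have E: "measure_pmf.expectation p (indicator {y} :: 'a \<Rightarrow> real) = pmf p y" for p :: "'a pmf" and y
    by (simp add: pmf.rep_eq)
  have close: "\<bar>?p (m * t) y - ?p (m * t + r) y\<bar> \<le> (1 - \<delta>) ^ m" for m r y
    using stationary_close[of "indicator {y}" x "step_dist K r x" m] x set_step_dist[OF x]
    unfolding E step_dist_add[symmetric] by (simp add: add.commute)
  have "Cauchy (\<lambda>s. ?p s y)" for y
  proof (rule metric_CauchyI)
    fix e :: real assume "0 < e"
    with power_tendsto_0 have "eventually (\<lambda>m. (1 - \<delta>) ^ m < e / 2) sequentially"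
      by (intro order_tendstoD) auto
    then obtain m where m: "(1 - \<delta>) ^ m < e / 2" by (auto simp: eventually_sequentially)
    have *: "\<bar>?p (m * t) y - ?p s y\<bar> < e / 2" if "s \<ge> m * t" for s
      using close[of m y "s - m * t"] m that by simp
    then show "\<exists>M. \<forall>s\<ge>M. \<forall>s'\<ge>M. dist (?p s y) (?p s' y) < e"
    proof (intro exI allI impI)
      fix s s' assume "m * t \<le> s" "m * t \<le> s'"
      from this[THEN *] show "dist (?p s y) (?p s' y) < e"
        unfolding dist_real_def abs_less_iff by linarith
    qed
  qed
  then have "\<exists>l. (\<lambda>s. ?p s y) \<longlonglongrightarrow> l" for y
    by (simp add: Cauchy_convergent_iff convergent_def)
  then obtain q where q: "\<And>y. (\<lambda>s. ?p s y) \<longlonglongrightarrow> q y" by metis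
  have q_nonneg: "q y \<ge> 0" for y
    using q by (rule LIMSEQ_le_const) auto
  have q_out: "q y = 0" if "y \<notin> S" for y
  proof -
    have "?p s y = 0" for s using set_step_dist[OF x] that by (simp add: pmf_eq_0_set_pmf subset_iff) blast
    with q[of y] show ?thesis by (simp add: LIMSEQ_const_iff)
  qed
  have "(\<lambda>s. \<Sum>y\<in>S. ?p s y) \<longlonglongrightarrow> (\<Sum>y\<in>S. q y)"
    by (intro tendsto_sum q)
  then have q_sum: "(\<Sum>y\<in>S. q y) = 1"
    by (simp add: sum_pmf_S[OF set_step_dist[OF x]] LIMSEQ_const_iff)
  have "(\<integral>\<^sup>+y. ennreal (q y) \<partial>count_space UNIV) = (\<Sum>y\<in>S. ennreal (q y))"
    using q_out by (intro nn_integral_count_space'[OF finite_S]) auto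
  also have "\<dots> = 1"
    using q_nonneg q_sum by (simp add: )
  finally have pmf: "pmf (embed_pmf q) y = q y" for y
    using q_nonneg by (simp add: pmf_embed_pmf)
  have set: "set_pmf (embed_pmf q) \<subseteq> S"
    using q_out unfolding subset_iff set_pmf_iff pmf by blast
  have "bind_pmf (embed_pmf q) K = embed_pmf q"
  proof (rule pmf_eqI)
    fix y
    have bind: "pmf (bind_pmf p K) y = (\<Sum>z\<in>S. pmf p z * pmf (K z) y)" if "set_pmf p \<subseteq> S" for p
      unfolding pmf_bind by (rule expectation_eq_sum[OF that])
    have "(\<lambda>s. \<Sum>z\<in>S. ?p s z * pmf (K z) y) \<longlonglongrightarrow> (\<Sum>z\<in>S. q z * pmf (K z) y)"
      by (intro tendsto_intros q)
    then have "(\<lambda>s. ?p (Suc s) y) \<longlonglongrightarrow> pmf (bind_pmf (embed_pmf q) K) y"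
      by (simp add: step_dist_Suc bind set set_step_dist[OF x] pmf)
    with q[of y] show "pmf (bind_pmf (embed_pmf q) K) y = pmf (embed_pmf q) y"
      unfolding pmf by (intro LIMSEQ_unique[OF _ LIMSEQ_Suc])
  qed
  with set show ?thesis by (auto simp: stationary_def)
qed

lemma stationary_dist: "stationary S K (stationary_dist S K)"
  unfolding stationary_dist_def using stationary_exists stationary_unique by (metis theI')

text \<open>Total variation distance is the excess of mass on the set \<open>B\<close> where the
  first law is at least the second, so the indicator of \<open>B\<close> is the test function to
  use.\<close>

lemma tv_dist_stationary_le:
  assumes x: "x \<in> S"
  shows "tv_dist S (step_dist K (m * t) x) (stationary_dist S K) \<le> (1 - \<delta>) ^ m"
proof -
  let ?\<mu> = "step_dist K (m * t) x" and ?\<pi> = "stationary_dist S K"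
  define B where "B = {y \<in> S. pmf ?\<mu> y \<ge> pmf ?\<pi> y}"
  have sub: "set_pmf ?\<mu> \<subseteq> S" "set_pmf ?\<pi> \<subseteq> S"
    using set_step_dist[OF x] stationary_dist by (auto simp: stationary_def)
  have B: "B \<subseteq> S" "finite B" using finite_S by (auto simp: B_def)
  have S: "(\<Sum>y\<in>S. f y) = (\<Sum>y\<in>B. f y) + (\<Sum>y\<in>S-B. f y)" for f :: "'a \<Rightarrow> real"
    using sum.subset_diff[OF B(1) finite_S, of f] by simp
  have E: "measure_pmf.expectation p (indicator B) = (\<Sum>y\<in>B. pmf p y)" for p :: "'a pmf"
    using B by (simp add: measure_measure_pmf_finite)
  have "(\<Sum>y\<in>S. \<bar>pmf ?\<mu> y - pmf ?\<pi> y\<bar>) =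
      (\<Sum>y\<in>B. pmf ?\<mu> y - pmf ?\<pi> y) + (\<Sum>y\<in>S-B. pmf ?\<pi> y - pmf ?\<mu> y)"
    unfolding S by (intro arg_cong2[where f="(+)"] sum.cong) (auto simp: B_def)
  also have "\<dots> = 2 * ((\<Sum>y\<in>B. pmf ?\<mu> y) - (\<Sum>y\<in>B. pmf ?\<pi> y))"
    using sum_pmf_S[OF sub(1)] sum_pmf_S[OF sub(2)]
    unfolding S by (simp add: sum_subtractf)
  finally have "tv_dist S ?\<mu> ?\<pi> = (\<Sum>y\<in>B. pmf ?\<mu> y) - (\<Sum>y\<in>B. pmf ?\<pi> y)"
    by (simp add: tv_dist_def)
  also have "\<dots> \<le> (1 - \<delta>) ^ m"
    using stationary_close[of "indicator B" x ?\<pi> m] x sub(2)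
    unfolding stationary_step[OF stationary_dist] E by (simp add: abs_le_iff)
  finally show ?thesis .
qed

lemma mixing_time_le:
  assumes "(1 - \<delta>) ^ m \<le> \<epsilon>"
  shows "mixing_time S K \<epsilon> \<le> enat (m * t)"
proof -
  have "tv_dist S (step_dist K (m * t) x) (stationary_dist S K) \<le> \<epsilon>" if "x \<in> S" for x
    using tv_dist_stationary_le[OF that, of m] assms by linarith
  then show ?thesis
    unfolding mixing_time_def by (intro Inf_lower CollectI exI conjI ballI) (rule refl)
qed

end

section \<open>Averages over permutations\<close>

lemma permutes_comp_left_cancel: "p permutes Y \<Longrightarrow> p \<circ> f = p \<circ> g \<longleftrightarrow> f = g"
  using permutes_inv_o(2)[of p Y] by (metis comp_assoc id_comp)

lemma permutes_comp_right_cancel: "p permutes Y \<Longrightarrow> f \<circ> p = g \<circ> p \<longleftrightarrow> f = g"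
  using permutes_inv_o(1)[of p Y] by (metis comp_assoc comp_id)

text \<open>The complements in \<open>X\<close> of \<open>D\<close> and of its image under
  \<open>h\<close> have equal size, so a bijection between them completes \<open>h\<close>.\<close>

lemma extend_to_permutation:
  assumes "finite X" "D \<subseteq> X" "inj_on h D" "h ` D \<subseteq> X"
  obtains \<sigma> where "\<sigma> permutes X" "\<And>i. i \<in> D \<Longrightarrow> \<sigma> i = h i"
proof -
  have fin: "finite D" "finite (h ` D)" using assms finite_subset by auto
  have "card (X - D) = card (X - h ` D)"
    using assms fin by (simp add: card_Diff_subset card_image)
  then obtain g where g: "bij_betw g (X - D) (X - h ` D)"
    using assms(1) by (meson finite_Diff finite_same_card_bij)
  define \<sigma> where "\<sigma> i = (if i \<in> D then h i else if i \<in> X then g i else i)" for i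
  have 1: "bij_betw \<sigma> D (h ` D)"
    using assms(3) by (intro bij_betw_cong[THEN iffD1, OF _ inj_on_imp_bij_betw]) (auto simp: \<sigma>_def)
  have 2: "bij_betw \<sigma> (X - D) (X - h ` D)"
    by (rule bij_betw_cong[THEN iffD1, OF _ g]) (auto simp: \<sigma>_def)
  have "bij_betw \<sigma> (D \<union> (X - D)) (h ` D \<union> (X - h ` D))"
    using 1 2 by (rule bij_betw_combine) auto
  then have "bij_betw \<sigma> X X"
    using assms by (simp add: Un_absorb1)
  then have "\<sigma> permutes X"
    by (rule bij_imp_permutes) (use assms(2) in \<open>auto simp: \<sigma>_def\<close>)
  then show thesis using that by (simp add: \<sigma>_def)
qed

text \<open>Left multiplication by the transposition of \<open>c\<close> and \<open>c'\<close>
  injects one fibre of evaluation at \<open>b\<close> into another, so all \<open>card Y\<close>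
  fibres have equal size.\<close>

lemma card_permutes_point:
  assumes "finite Y" "a \<in> Y" "b \<in> Y"
  shows "card Y * card {\<sigma>. \<sigma> permutes Y \<and> \<sigma> b = a} = fact (card Y)"
proof -
  let ?T = "\<lambda>c. {\<sigma>. \<sigma> permutes Y \<and> \<sigma> b = c}"
  have fin: "finite {\<sigma>. \<sigma> permutes Y}" using assms(1) by (rule finite_permutations)
  have le: "card (?T c) \<le> card (?T c')" if "c \<in> Y" "c' \<in> Y" for c c'
  proof (rule card_inj_on_le)
    show "inj_on (\<lambda>\<sigma>. Transposition.transpose c c' \<circ> \<sigma>) (?T c)"
      by (rule inj_onI) (metis comp_assoc transpose_comp_involutory id_comp)
    show "(\<lambda>\<sigma>. Transposition.transpose c c' \<circ> \<sigma>) ` ?T c \<subseteq> ?T c'"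
      using that by (auto intro!: permutes_compose permutes_swap_id)
    show "finite (?T c')" using fin by (rule rev_finite_subset) auto
  qed
  have "fact (card Y) = card {\<sigma>. \<sigma> permutes Y}"
    using assms(1) by (simp add: card_permutations)
  also have "{\<sigma>. \<sigma> permutes Y} = (\<Union>c\<in>Y. ?T c)"
    using assms(3) permutes_in_image by fastforce
  also have "card \<dots> = (\<Sum>c\<in>Y. card (?T c))"
    using assms(1) by (intro card_UN_disjoint) (auto intro: rev_finite_subset[OF fin])
  also have "\<dots> = (\<Sum>c\<in>Y. card (?T a))"
    using le assms(2) by (intro sum.cong antisym) auto
  finally show ?thesis by simp
qed

section \<open>Products of uniform permutations from two pointwise stabilizers\<close>

definition perm_avg :: "'a set \<Rightarrow> (('a \<Rightarrow> 'a) \<Rightarrow> real) \<Rightarrow> real" where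
  "perm_avg Y f = (\<Sum>\<sigma> | \<sigma> permutes Y. f \<sigma>) / fact (card Y)"

lemma perm_avg_mono:
  "(\<And>\<sigma>. \<sigma> permutes Y \<Longrightarrow> f \<sigma> \<le> g \<sigma>) \<Longrightarrow> perm_avg Y f \<le> perm_avg Y g"
  by (auto simp: perm_avg_def intro!: divide_right_mono sum_mono)

lemma perm_avg_cong:
  "(\<And>\<sigma>. \<sigma> permutes Y \<Longrightarrow> f \<sigma> = g \<sigma>) \<Longrightarrow> perm_avg Y f = perm_avg Y g"
  by (auto simp: perm_avg_def intro!: sum.cong)

lemma perm_avg_const: "finite Y \<Longrightarrow> perm_avg Y (\<lambda>_. c) = c"
  by (simp add: perm_avg_def card_permutations)

lemma perm_avg_mult: "perm_avg Y (\<lambda>\<sigma>. c * f \<sigma>) = c * perm_avg Y f"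
  by (simp add: perm_avg_def sum_distrib_left)

lemma perm_avg_diff: "perm_avg Y (\<lambda>\<sigma>. f \<sigma> - g \<sigma>) = perm_avg Y f - perm_avg Y g"
  by (simp add: perm_avg_def sum_subtractf diff_divide_distrib)

text \<open>Choose \<open>a\<close> to agree with \<open>z\<close> on \<open>B - A\<close>, where
  the hypothesis keeps the values outside \<open>A\<close>; on \<open>A \<inter> B\<close> both are
  the identity. Then \<open>inv a \<circ> z\<close> fixes \<open>B\<close> pointwise.\<close>

lemma factorization_fixing:
  assumes X: "finite X" "A \<subseteq> X" "B \<subseteq> X" and z: "z permutes X - A \<inter> B" "z ` (B - A) \<inter> A = {}"
  obtains a b where "a permutes X - A" "b permutes X - B" "a \<circ> b = z"
proof -
  have zX: "z permutes X" using z(1) by (rule permutes_subset) auto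
  have "z ` (B - A) \<subseteq> X - A"
    using z(2) X(3) permutes_in_image[OF zX] by auto
  then obtain a where a: "a permutes X - A" "\<And>i. i \<in> B - A \<Longrightarrow> a i = z i"
    using X permutes_inj_on[OF z(1)]
    by (metis extend_to_permutation[of "X - A" "B - A" z] finite_Diff Diff_mono order_refl)
  have ab: "a i = z i" if "i \<in> B" for i
    using that a permutes_not_in[OF a(1)] permutes_not_in[OF z(1)] by (cases "i \<in> A") auto
  have aX: "a permutes X" using a(1) by (rule permutes_subset) auto
  have "inv a \<circ> z permutes X"
    using zX aX by (intro permutes_compose permutes_inv)
  then have "inv a \<circ> z permutes X - B"
    by (rule permutes_superset) (use ab permutes_inverses(2)[OF aX] in \<open>auto simp flip: ab\<close>)
  moreover have "a \<circ> (inv a \<circ> z) = z"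
    using permutes_inverses(1)[OF aX] by auto
  ultimately show thesis using that a(1) by blast
qed

text \<open>Any other factorization is \<open>(a \<circ> c, inv c \<circ> b)\<close> with
  \<open>c\<close> fixing both \<open>A\<close> and \<open>B\<close> pointwise, so factorizations
  correspond to permutations of \<open>X - (A \<union> B)\<close>.\<close>

lemma card_factorizations_fixing:
  assumes X: "finite X" and a: "a permutes X - A" and b: "b permutes X - B"
  shows "card {(p, q). p permutes X - A \<and> q permutes X - B \<and> p \<circ> q = a \<circ> b} = fact (card (X - (A \<union> B)))"
proof -
  let ?F = "{(p, q). p permutes X - A \<and> q permutes X - B \<and> p \<circ> q = a \<circ> b}"
  let ?C = "{c. c permutes X - (A \<union> B)}"
  have "bij_betw (\<lambda>c. (a \<circ> c, inv c \<circ> b)) ?C ?F"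
  proof (rule bij_betw_imageI)
    show "inj_on (\<lambda>c. (a \<circ> c, inv c \<circ> b)) ?C"
      by (rule inj_onI) (simp add: permutes_comp_left_cancel[OF a])
    show "(\<lambda>c. (a \<circ> c, inv c \<circ> b)) ` ?C = ?F"
    proof (intro equalityI subsetI)
      fix pq assume "pq \<in> (\<lambda>c. (a \<circ> c, inv c \<circ> b)) ` ?C"
      then obtain c where c: "c permutes X - (A \<union> B)" and pq: "pq = (a \<circ> c, inv c \<circ> b)" by auto
      have "c permutes X - A" "c permutes X - B"
        using c by (auto intro: permutes_subset)
      moreover have "a \<circ> c \<circ> (inv c \<circ> b) = a \<circ> b"
        using permutes_inverses(1)[OF c] by auto
      ultimately show "pq \<in> ?F"
        using a b by (auto simp: pq intro!: permutes_compose permutes_inv)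
    next
      fix pq assume "pq \<in> ?F"
      then obtain p q where pq: "pq = (p, q)" "p permutes X - A" "q permutes X - B" "p \<circ> q = a \<circ> b"
        by auto
      define c where "c = inv a \<circ> p"
      have cA: "c permutes X - A" unfolding c_def using a pq by (intro permutes_compose permutes_inv)
      have p: "p = a \<circ> c" unfolding c_def using permutes_inverses(1)[OF a] by auto
      have cq: "c \<circ> q = b"
        using pq(4) permutes_inv_o(2)[OF a] unfolding c_def by (metis comp_assoc id_comp)
      then have "c = b \<circ> inv q"
        using permutes_inv_o(1)[OF pq(3)] by (metis comp_assoc comp_id)
      then have cB: "c permutes X - B"
        using b pq(3) by (auto intro!: permutes_compose permutes_inv)
      have "c permutes X - (A \<union> B)"
        using cA by (rule permutes_superset) (use permutes_not_in[OF cB] in auto)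
      moreover have "q = inv c \<circ> b"
        using cq permutes_inv_o(2)[OF cA] by (metis comp_assoc id_comp)
      ultimately show "pq \<in> (\<lambda>c. (a \<circ> c, inv c \<circ> b)) ` ?C"
        using p pq(1) by auto
    qed
  qed
  then show ?thesis
    using X by (simp add: bij_betw_same_card[symmetric] card_permutations)
qed

text \<open>Union bound over the pairs \<open>(a, b)\<close> with \<open>\<sigma> b = a\<close>;
  each such event has probability \<open>1 / card Y\<close>.\<close>

lemma card_permutes_hitting:
  assumes "finite Y" "A \<subseteq> Y" "B \<subseteq> Y"
  shows "card Y * card {\<sigma>. \<sigma> permutes Y \<and> \<sigma> ` B \<inter> A \<noteq> {}} \<le> card A * card B * fact (card Y)"
proof -
  have fin: "finite A" "finite B" using assms finite_subset by auto
  have "{\<sigma>. \<sigma> permutes Y \<and> \<sigma> ` B \<inter> A \<noteq> {}} = (\<Union>(a, b)\<in>A \<times> B. {\<sigma>. \<sigma> permutes Y \<and> \<sigma> b = a})"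
    by auto
  also have "card \<dots> \<le> (\<Sum>(a, b)\<in>A \<times> B. card {\<sigma>. \<sigma> permutes Y \<and> \<sigma> b = a})"
    unfolding split_def by (rule card_UN_le) (use fin in auto)
  finally have "card Y * card {\<sigma>. \<sigma> permutes Y \<and> \<sigma> ` B \<inter> A \<noteq> {}} \<le>
      (\<Sum>(a, b)\<in>A \<times> B. card Y * card {\<sigma>. \<sigma> permutes Y \<and> \<sigma> b = a})"
    by (simp add: split_def flip: sum_distrib_left)
  also have "\<dots> = (\<Sum>(a, b)\<in>A \<times> B. fact (card Y))"
    using assms by (intro sum.cong refl) (auto simp: card_permutes_point subset_iff)
  finally show ?thesis by (simp add: card_cartesian_product)
qed

text \<open>Products of independent uniform elements of the two stabilizers are uniform on the set of
  permutations \<open>z\<close> of \<open>X - A \<inter> B\<close> with \<open>z ` (B - A) \<inter> A = {}\<close>, and few permutations violate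
  this condition.\<close>

lemma perm_avg_compose:
  assumes X: "finite X" "A \<subseteq> X" "B \<subseteq> X" "card A \<le> d" "card B \<le> d" "d < card X"
    and \<psi>: "\<And>\<sigma>. 0 \<le> \<psi> \<sigma>" "\<And>\<sigma>. \<psi> \<sigma> \<le> 1"
  shows "perm_avg (X - A \<inter> B) \<psi> - (real d)\<^sup>2 / real (card X - d) \<le>
    perm_avg (X - A) (\<lambda>a. perm_avg (X - B) (\<lambda>b. \<psi> (a \<circ> b)))"
proof -
  define P where "P = {a. a permutes X - A}"
  define Q where "Q = {a. a permutes X - B}"
  define G where "G = {a. a permutes X - A \<inter> B}"
  define Z where "Z = {z. z permutes X - A \<inter> B \<and> z ` (B - A) \<inter> A = {}}"
  define N where "N = (fact (card (X - (A \<union> B))) :: nat)"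
  have fin: "finite P" "finite Q" "finite G" "finite Z"
    using X(1) by (auto simp: P_def Q_def G_def Z_def finite_permutations)
  have cards: "card P = fact (card (X - A))" "card Q = fact (card (X - B))"
    "card G = fact (card (X - A \<inter> B))"
    using X(1) by (auto simp: P_def Q_def G_def card_permutations)
  have ZG: "Z \<subseteq> G" by (auto simp: Z_def G_def)
  have PQ: "(\<lambda>(a, b). a \<circ> b) ` (P \<times> Q) \<subseteq> Z"
  proof clarify
    fix a b assume "a \<in> P" "b \<in> Q"
    then have a: "a permutes X - A" and b: "b permutes X - B" by (auto simp: P_def Q_def)
    have "a permutes X - A \<inter> B" "b permutes X - A \<inter> B"
      using a b by (auto intro: permutes_subset)
    then have "a \<circ> b permutes X - A \<inter> B" by (intro permutes_compose)
    moreover have "a (b i) \<notin> A" if "i \<in> B" "i \<notin> A" for i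
      using that X(3) permutes_not_in[OF b, of i] permutes_in_image[OF a, of i] by auto
    ultimately show "a \<circ> b \<in> Z" by (auto simp: Z_def)
  qed
  have fib: "card {x \<in> P \<times> Q. (\<lambda>(a, b). a \<circ> b) x = z} = N" if "z \<in> Z" for z
  proof -
    obtain a b where ab: "a permutes X - A" "b permutes X - B" "a \<circ> b = z"
      using factorization_fixing[OF X(1-3), of z] \<open>z \<in> Z\<close> by (auto simp: Z_def)
    have "{x \<in> P \<times> Q. (\<lambda>(a, b). a \<circ> b) x = z} =
        {(p, q). p permutes X - A \<and> q permutes X - B \<and> p \<circ> q = a \<circ> b}"
      using ab by (auto simp: P_def Q_def)
    then show ?thesis
      using card_factorizations_fixing[OF X(1) ab(1,2)] by (simp add: N_def)
  qed
  \<comment> \<open>Each \<open>z\<close> in \<open>Z\<close> has exactly \<open>N\<close>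
    factorizations, so the image of the uniform law on \<open>P \<times> Q\<close> is uniform on
    \<open>Z\<close>.\<close>
  have sums: "(\<Sum>(a, b)\<in>P \<times> Q. f (a \<circ> b)) = real N * (\<Sum>z\<in>Z. f z)" for f :: "('a \<Rightarrow> 'a) \<Rightarrow> real"
  proof -
    have "(\<Sum>(a, b)\<in>P \<times> Q. f (a \<circ> b)) =
        (\<Sum>z\<in>Z. \<Sum>x | x \<in> P \<times> Q \<and> (\<lambda>(a, b). a \<circ> b) x = z. f ((\<lambda>(a, b). a \<circ> b) x))"
      using PQ fin by (subst sum.group) (auto simp: split_def)
    also have "\<dots> = (\<Sum>z\<in>Z. \<Sum>x | x \<in> P \<times> Q \<and> (\<lambda>(a, b). a \<circ> b) x = z. f z)"
      by (intro sum.cong) auto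
    also have "\<dots> = (\<Sum>z\<in>Z. real N * f z)"
      using fib by (intro sum.cong) auto
    finally show ?thesis by (simp add: sum_distrib_left)
  qed
  have PQZ: "real (card P) * real (card Q) = real N * real (card Z)"
    using sums[of "\<lambda>_. 1"] by (simp add: card_cartesian_product)
  have pos: "card P > 0" "card Q > 0" "card G > 0" by (simp_all add: cards)
  then have Zpos: "card Z > 0" and Npos: "N > 0" using PQZ by (auto simp: N_def intro!: Nat.gr0I)
  have "perm_avg (X - A) (\<lambda>a. perm_avg (X - B) (\<lambda>b. \<psi> (a \<circ> b))) =
      (\<Sum>(a, b)\<in>P \<times> Q. \<psi> (a \<circ> b)) / (real (card P) * real (card Q))"
    by (simp add: perm_avg_def P_def[symmetric] Q_def[symmetric] cards sum.cartesian_product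
        flip: sum_divide_distrib)
  also have "\<dots> = (\<Sum>z\<in>Z. \<psi> z) / card Z"
    using Npos Zpos unfolding PQZ sums by simp
  \<comment> \<open>As \<open>\<psi>\<close> is nonnegative, dividing by the larger
    \<open>card G\<close> only decreases the quotient.\<close>
  also have "\<dots> \<ge> (\<Sum>z\<in>Z. \<psi> z) / card G"
    using Zpos card_mono[OF fin(3) ZG] \<psi> by (intro divide_left_mono sum_nonneg) auto
  finally have 1: "(\<Sum>z\<in>Z. \<psi> z) / card G \<le> perm_avg (X - A) (\<lambda>a. perm_avg (X - B) (\<lambda>b. \<psi> (a \<circ> b)))" .
  define Y where "Y = X - A \<inter> B"
  have finAB: "finite A" "finite B" using X finite_subset by auto
  have "card (A \<inter> B) \<le> d" using X(4) card_mono[OF finAB(1), of "A \<inter> B"] by auto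
  then have cardY: "card X - d \<le> card Y" "card Y > 0"
    using X card_Diff_subset_Int[of X "A \<inter> B"] finAB card_mono[of "A \<inter> B" "X \<inter> (A \<inter> B)"]
    unfolding Y_def by (auto simp: Int_absorb1 le_infI1)
  \<comment> \<open>A permutation in \<open>G\<close> fixes \<open>A \<inter> B\<close> pointwise,
    so a point of \<open>B - A\<close> that lands in \<open>A\<close> lands in
    \<open>A - B\<close>.\<close>
  have GZ: "G - Z = {\<sigma>. \<sigma> permutes Y \<and> \<sigma> ` (B - A) \<inter> (A - B) \<noteq> {}}"
  proof -
    have "\<sigma> i \<notin> A \<inter> B" if "\<sigma> permutes X - A \<inter> B" "i \<in> B - A" for \<sigma> i
      using permutes_in_image[OF that(1), of i] that(2) X(3) by auto
    then show ?thesis unfolding G_def Z_def Y_def by fastforce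
  qed
  have "card (A - B) * card (B - A) \<le> d * d"
    using X(4,5) finAB by (intro mult_mono) (auto intro: order_trans[OF card_mono])
  then have "card Y * card (G - Z) \<le> d * d * card G"
    using card_permutes_hitting[of Y "A - B" "B - A"] X unfolding GZ cards Y_def[symmetric]
    by (intro order_trans[OF card_permutes_hitting mult_le_mono1]) (auto simp: Y_def)
  then have "real (card Y) * card (G - Z) \<le> (real d)\<^sup>2 * card G"
    by (simp add: power2_eq_square flip: of_nat_mult)
  then have "card (G - Z) / card G \<le> (real d)\<^sup>2 / card Y"
    using cardY(2) pos by (simp add: divide_simps mult.commute)
  also have "\<dots> \<le> (real d)\<^sup>2 / real (card X - d)"
    using cardY X(6) by (intro divide_left_mono) auto
  finally have 2: "card (G - Z) / card G \<le> (real d)\<^sup>2 / real (card X - d)" .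
  have "(\<Sum>z\<in>G. \<psi> z) = (\<Sum>z\<in>Z. \<psi> z) + (\<Sum>z\<in>G - Z. \<psi> z)"
    using sum.subset_diff[OF ZG fin(3), of \<psi>] by simp
  also have "\<dots> \<le> (\<Sum>z\<in>Z. \<psi> z) + card (G - Z)"
    using sum_bounded_above[of "G - Z" \<psi> 1] \<psi>(2) by simp
  finally have "perm_avg Y \<psi> \<le> ((\<Sum>z\<in>Z. \<psi> z) + card (G - Z)) / card G"
    unfolding perm_avg_def using cards(3) by (auto simp: Y_def G_def intro!: divide_right_mono)
  with 1 2 show ?thesis by (simp add: Y_def add_divide_distrib)
qed

section \<open>Graphs with an action of a symmetric group\<close>

lemma expectation_in_unit:
  fixes \<phi> :: "'s \<Rightarrow> real"
  assumes "\<And>z. 0 \<le> \<phi> z" "\<And>z. \<phi> z \<le> 1"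
  shows "0 \<le> measure_pmf.expectation p \<phi>" "measure_pmf.expectation p \<phi> \<le> 1"
proof -
  show "0 \<le> measure_pmf.expectation p \<phi>" using assms by simp
  have "integrable (measure_pmf p) \<phi>"
    using assms by (intro measure_pmf.integrable_const_bound[where B=1]) auto
  then show "measure_pmf.expectation p \<phi> \<le> 1"
    using assms by (intro measure_pmf.integral_le_const) auto
qed

lemma other_endpoint: "(THE w. {v, u} = {v, w}) = u"
  by (auto simp: doubleton_eq_iff)

text \<open>An abstract form of the value of an FI-graph at one large degree. \<open>ptype\<close>
  colours ordered pairs of vertices with \<open>R\<close> colours so that pairs of equal colour lie
  in one orbit; one orbit may carry several colours. \<open>large\<close> makes the error of
  \<open>perm_avg_compose\<close> smaller than one half.\<close>

locale perm_graph =
  fixes X :: "'a set" and V :: "'v set" and E :: "'v set set"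
    and act :: "('a \<Rightarrow> 'a) \<Rightarrow> 'v \<Rightarrow> 'v"
    and d R :: nat and ptype :: "'v \<times> 'v \<Rightarrow> nat"
  assumes finite_X: "finite X" and graph: "finite_graph V E"
    and act_vertex: "\<sigma> permutes X \<Longrightarrow> v \<in> V \<Longrightarrow> act \<sigma> v \<in> V"
    and act_edge: "\<sigma> permutes X \<Longrightarrow> e \<in> E \<Longrightarrow> act \<sigma> ` e \<in> E"
    and act_id: "v \<in> V \<Longrightarrow> act id v = v"
    and act_comp: "\<sigma> permutes X \<Longrightarrow> \<tau> permutes X \<Longrightarrow> v \<in> V \<Longrightarrow> act (\<sigma> \<circ> \<tau>) v = act \<sigma> (act \<tau> v)"
    and support_exists:
      "v \<in> V \<Longrightarrow> \<exists>A\<subseteq>X. card A \<le> d \<and> (\<forall>\<sigma>. \<sigma> permutes X - A \<longrightarrow> act \<sigma> v = v)"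
    and ptype_less: "p \<in> V \<times> V \<Longrightarrow> ptype p < R"
    and ptype_eq: "(u, v) \<in> V \<times> V \<Longrightarrow> (u', v') \<in> V \<times> V \<Longrightarrow> ptype (u, v) = ptype (u', v') \<Longrightarrow>
      \<exists>\<sigma>. \<sigma> permutes X \<and> act \<sigma> u = u' \<and> act \<sigma> v = v'"
    and d_less: "d < card X" and large: "2 * d\<^sup>2 < card X - d"
begin

lemma finite_V: "finite V"
  using graph by (simp add: finite_graph_def)

lemma edgeE:
  assumes "e \<in> E"
  obtains u v where "u \<in> V" "v \<in> V" "e = {u, v}"
  using assms graph by (auto simp: finite_graph_def)

lemma edge_subset: "e \<in> E \<Longrightarrow> e \<subseteq> V"
  by (auto elim!: edgeE)

lemma finite_E: "finite E"
  using finite_V edge_subset by (meson PowI finite_Pow_iff finite_subset subsetI)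

lemma act_inv:
  assumes "\<sigma> permutes X" "v \<in> V"
  shows "act (inv \<sigma>) (act \<sigma> v) = v" "act \<sigma> (act (inv \<sigma>) v) = v"
  using assms act_comp[of "inv \<sigma>" \<sigma> v] act_comp[of \<sigma> "inv \<sigma>" v]
  by (simp_all add: permutes_inv permutes_inv_o act_id)

lemma act_inj: "\<sigma> permutes X \<Longrightarrow> u \<in> V \<Longrightarrow> v \<in> V \<Longrightarrow> act \<sigma> u = act \<sigma> v \<longleftrightarrow> u = v"
  by (metis act_inv(1))

lemma act_comp_image:
  assumes "\<sigma> permutes X" "\<tau> permutes X" "e \<subseteq> V"
  shows "act (\<sigma> \<circ> \<tau>) ` e = act \<sigma> ` act \<tau> ` e"
  unfolding image_image using assms act_comp by (intro image_cong) auto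

lemma act_id_image: "e \<subseteq> V \<Longrightarrow> act id ` e = e"
  by (force simp: act_id)

lemma permutes_X: "\<sigma> permutes X - A \<Longrightarrow> \<sigma> permutes X"
  by (erule permutes_subset) auto

section \<open>Stabilizers and supports\<close>

definition stab :: "'v \<Rightarrow> ('a \<Rightarrow> 'a) set" where
  "stab v = {\<sigma>. \<sigma> permutes X \<and> act \<sigma> v = v}"

definition supports :: "'a set \<Rightarrow> 'v \<Rightarrow> bool" where
  "supports A v \<longleftrightarrow> A \<subseteq> X \<and> card A \<le> d \<and> (\<forall>\<sigma>. \<sigma> permutes X - A \<longrightarrow> act \<sigma> v = v)"

text \<open>The error term of \<open>perm_avg_compose\<close> when both fixed sets have at most
  \<open>d\<close> points.\<close>

definition \<eta> :: real where "\<eta> = (real d)\<^sup>2 / real (card X - d)"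

lemma \<eta>_bounds: "0 \<le> \<eta>" "\<eta> < 1 / 2"
proof -
  have "2 * (real d)\<^sup>2 < real (card X - d)"
    using large by (metis of_nat_less_iff of_nat_mult of_nat_numeral of_nat_power)
  then show "\<eta> < 1 / 2" using d_less by (simp add: \<eta>_def divide_simps)
qed (simp add: \<eta>_def)

lemma finite_stab: "finite (stab v)"
  unfolding stab_def using finite_permutations[OF finite_X] by (rule rev_finite_subset) auto

lemma stab_id: "v \<in> V \<Longrightarrow> id \<in> stab v"
  by (simp add: stab_def act_id)

text \<open>The stabilizer meets the subgroup fixing \<open>A \<inter> B\<close> pointwise in more than half of its
  elements, hence contains it.\<close>

lemma supports_Int:
  assumes v: "v \<in> V" and A: "supports A v" and B: "supports B v"
  shows "supports (A \<inter> B) v"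
proof -
  let ?G = "{\<sigma>. \<sigma> permutes X - A \<inter> B}"
  let ?H = "{\<sigma> \<in> ?G. act \<sigma> v = v}"
  have fin: "finite ?G" "finite ?H" using finite_X by (auto simp: finite_permutations)
  have cG: "card ?G = fact (card (X - A \<inter> B))"
    using finite_X by (intro card_permutations) auto
  \<comment> \<open>Permutations fixing \<open>A\<close> or \<open>B\<close> pointwise fix
    \<open>v\<close>, and so do their products. The average of this indicator over products is
    therefore 0, and \<open>perm_avg_compose\<close> bounds the share of \<open>?G\<close> that
    moves \<open>v\<close> by \<open>\<eta>\<close>.\<close>
  define \<psi> where "\<psi> \<sigma> = (of_bool (act \<sigma> v \<noteq> v) :: real)" for \<sigma>
  have "perm_avg (X - A) (\<lambda>a. perm_avg (X - B) (\<lambda>b. \<psi> (a \<circ> b))) =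
      perm_avg (X - A) (\<lambda>a. perm_avg (X - B) (\<lambda>b. 0))"
    using A B v by (intro perm_avg_cong) (auto simp: \<psi>_def supports_def act_comp permutes_X)
  also have "\<dots> = 0" by (simp add: perm_avg_def)
  finally have "perm_avg (X - A \<inter> B) \<psi> \<le> \<eta>"
    using perm_avg_compose[of X A B d \<psi>] A B finite_X d_less
    by (simp add: supports_def \<eta>_def \<psi>_def)
  also have "perm_avg (X - A \<inter> B) \<psi> = card (?G - ?H) / card ?G"
  proof -
    have "(\<Sum>\<sigma>\<in>?G. \<psi> \<sigma>) = card (?G \<inter> {\<sigma>. act \<sigma> v \<noteq> v})"
      using fin by (simp add: \<psi>_def sum.If_cases of_bool_def)
    also have "?G \<inter> {\<sigma>. act \<sigma> v \<noteq> v} = ?G - ?H" by auto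
    finally show ?thesis unfolding perm_avg_def cG by simp
  qed
  finally have "card (?G - ?H) / card ?G < 1 / 2"
    using \<eta>_bounds(2) by linarith
  moreover have "real (card ?G) > 0" unfolding cG by simp
  ultimately have "real (card (?G - ?H)) < 1 / 2 * card ?G"
    by (simp only: pos_divide_less_eq)
  then have "2 * card (?G - ?H) < card ?G" by linarith
  moreover have "card (?G - ?H) = card ?G - card ?H" "card ?H \<le> card ?G"
    using fin by (intro card_Diff_subset card_mono; auto)+
  ultimately have half: "2 * card ?H > card ?G" by simp
  have "act z v = v" if z: "z permutes X - A \<inter> B" for z
  proof -
    \<comment> \<open>\<open>?K\<close> is as large as \<open>?H\<close>; two subsets of
      \<open>?G\<close> that each exceed half of it must meet, which writes \<open>z\<close> as a
      product of two elements of \<open>?H\<close>.\<close>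
    let ?K = "(\<lambda>w. z \<circ> inv w) ` ?H"
    have inj: "inj_on (\<lambda>w. z \<circ> inv w) ?H"
    proof (rule inj_onI)
      fix w w' assume w: "w \<in> ?H" "w' \<in> ?H" and "z \<circ> inv w = z \<circ> inv w'"
      then have "inv w = inv w'"
        by (simp add: permutes_comp_left_cancel[OF z])
      then show "w = w'" using w by (metis (mono_tags) mem_Collect_eq permutes_inv_inv)
    qed
    have "card (?H \<inter> ?K) \<noteq> 0"
    proof
      assume "card (?H \<inter> ?K) = 0"
      then have "card (?H \<union> ?K) = 2 * card ?H"
        using card_Un_Int[OF fin(2) finite_imageI[OF fin(2)], of "\<lambda>w. z \<circ> inv w"] card_image[OF inj]
        by linarith
      moreover have "?H \<union> ?K \<subseteq> ?G"
        using z by (auto intro!: permutes_compose permutes_inv)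
      ultimately show False
        using half card_mono[OF fin(1), of "?H \<union> ?K"] by simp
    qed
    then obtain w w' where w: "w \<in> ?H" "w' \<in> ?H" "z \<circ> inv w = w'" by (auto simp: card_eq_0_iff)
    have "z = w' \<circ> w" using w permutes_inv_o(2)[of w "X - A \<inter> B"] by (auto simp: comp_assoc)
    then show ?thesis using w v by (auto simp: act_comp permutes_X)
  qed
  then show ?thesis
    using A B card_mono[of A "A \<inter> B"] finite_subset[OF _ finite_X] by (fastforce simp: supports_def)
qed

text \<open>Conjugation: if \<open>\<sigma>\<close> fixes the image of \<open>A\<close> under
  \<open>h\<close> pointwise, then \<open>inv h \<circ> (\<sigma> \<circ> h)\<close> fixes
  \<open>A\<close> pointwise and hence fixes \<open>v\<close>.\<close>

lemma supports_image:
  assumes v: "v \<in> V" and A: "supports A v" and h: "h permutes X"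
  shows "supports (h ` A) (act h v)"
  unfolding supports_def
proof (intro conjI allI impI)
  show "h ` A \<subseteq> X" using A h by (auto simp: supports_def permutes_in_image)
  show "card (h ` A) \<le> d"
    using A by (simp add: supports_def card_image permutes_inj_on[OF h])
  fix \<sigma> assume \<sigma>: "\<sigma> permutes X - h ` A"
  note \<sigma>X = permutes_X[OF \<sigma>]
  have "inv h \<circ> (\<sigma> \<circ> h) permutes X"
    using h \<sigma>X by (intro permutes_compose permutes_inv)
  then have *: "inv h \<circ> (\<sigma> \<circ> h) permutes X - A"
    by (rule permutes_superset) (use permutes_not_in[OF \<sigma>] permutes_inverses(2)[OF h] in auto)
  have "act \<sigma> (act h v) = act h (act (inv h) (act \<sigma> (act h v)))"
    using h \<sigma>X v by (simp add: act_inv act_vertex)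
  also have "act (inv h) (act \<sigma> (act h v)) = act (inv h \<circ> (\<sigma> \<circ> h)) v"
    using h \<sigma>X v by (simp add: act_comp permutes_compose permutes_inv)
  also have "\<dots> = v" using A * by (simp add: supports_def)
  finally show "act \<sigma> (act h v) = act h v" .
qed

text \<open>A support of minimal cardinality is preserved by the stabilizer.\<close>

lemma small_index_support:
  assumes v: "v \<in> V"
  shows "\<exists>M. supports M v \<and> card (stab v) \<le> d ^ d * card {\<sigma>. \<sigma> permutes X - M}"
proof -
  have "\<exists>M. supports M v" using support_exists[OF v] by (auto simp: supports_def)
  then obtain M where M: "supports M v" and min: "\<And>B. supports B v \<Longrightarrow> card M \<le> card B"
    using ex_has_least_nat[of "\<lambda>M. supports M v" _ card] by auto
  have finM: "finite M" using M finite_subset[OF _ finite_X] by (auto simp: supports_def)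
  \<comment> \<open>\<open>h\<close> carries \<open>M\<close> to another support of the same vertex,
    and the intersection of the two is again a support; minimality forces it to be
    \<open>M\<close>.\<close>
  have inv_M: "h ` M = M" if "h \<in> stab v" for h
  proof -
    have h: "h permutes X" "act h v = v" using that by (auto simp: stab_def)
    have "supports (M \<inter> h ` M) v"
      using supports_Int[OF v M] supports_image[OF v M h(1)] h(2) by simp
    from min[OF this] have "M \<inter> h ` M = M"
      using finM by (intro card_subset_eq) (auto intro!: antisym card_mono)
    then have "M \<subseteq> h ` M" by auto
    then show ?thesis
      using finM card_image[OF permutes_inj_on[OF h(1)], of M] card_subset_eq[of "h ` M" M] by auto
  qed
  let ?F = "{\<sigma>. \<sigma> permutes X - M}"
  \<comment> \<open>\<open>rep f\<close> is one stabilizer element acting on \<open>M\<close> as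
    \<open>f\<close>. Dividing \<open>h\<close> by the representative of its own restriction leaves
    a permutation fixing \<open>M\<close> pointwise, so \<open>h\<close> is encoded by a self-map of
    \<open>M\<close> and such a permutation.\<close>
  define rep where "rep f = (SOME h. h \<in> stab v \<and> restrict h M = f)" for f
  have rep: "rep (restrict h M) \<in> stab v" "restrict (rep (restrict h M)) M = restrict h M"
    if "h \<in> stab v" for h
    using someI[of "\<lambda>g. g \<in> stab v \<and> restrict g M = restrict h M" h] that
    by (auto simp: rep_def)
  let ?f = "\<lambda>h. (restrict h M, inv (rep (restrict h M)) \<circ> h)"
  have "card (stab v) \<le> card ((M \<rightarrow>\<^sub>E M) \<times> ?F)"
  proof (rule card_inj_on_le[of ?f])
    show "inj_on ?f (stab v)"
    proof (rule inj_onI)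
      fix h h' assume h: "h \<in> stab v" "h' \<in> stab v" "?f h = ?f h'"
      have "rep (restrict h M) permutes X" using rep(1)[OF h(1)] by (simp add: stab_def)
      moreover have "inv (rep (restrict h M)) \<circ> h = inv (rep (restrict h M)) \<circ> h'"
        using h(3) by auto
      ultimately show "h = h'"
        using permutes_comp_left_cancel[OF permutes_inv, of "rep (restrict h M)" X h h'] by blast
    qed
    show "?f ` stab v \<subseteq> (M \<rightarrow>\<^sub>E M) \<times> ?F"
    proof clarify
      fix h assume h: "h \<in> stab v"
      define r where "r = rep (restrict h M)"
      have r: "r permutes X" using rep(1)[OF h] by (simp add: stab_def r_def)
      have eq: "r i = h i" if "i \<in> M" for i
        using rep(2)[OF h] that unfolding r_def by (metis restrict_apply')
      have "inv r \<circ> h permutes X"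
        using r h by (auto simp: stab_def intro!: permutes_compose permutes_inv)
      then have "inv r \<circ> h permutes X - M"
        by (rule permutes_superset) (use eq permutes_inverses(2)[OF r] in \<open>auto simp flip: eq\<close>)
      then show "restrict h M \<in> M \<rightarrow>\<^sub>E M \<and> inv (rep (restrict h M)) \<circ> h \<in> ?F"
        using inv_M[OF h] by (auto simp: r_def)
    qed
    show "finite ((M \<rightarrow>\<^sub>E M) \<times> ?F)"
      using finM finite_X by (intro finite_cartesian_product finite_PiE finite_permutations) auto
  qed
  also have "\<dots> = card M ^ card M * card ?F"
    using finM by (simp add: card_cartesian_product card_funcsetE)
  also have "card M ^ card M \<le> d ^ d"
  proof (cases "card M = 0")
    \<comment> \<open>Here the left side is \<open>0 ^ 0 = 1\<close>, and
      \<open>1 \<le> d ^ d\<close> holds also for \<open>d = 0\<close>.\<close>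
    case True
    then show ?thesis by (cases "d = 0") (auto simp: Suc_le_eq)
  next
    case False
    have "card M \<le> d" using M by (simp add: supports_def)
    then show ?thesis using False
      by (meson order_trans power_increasing power_mono le0 less_one not_le)
  qed
  finally show ?thesis using M by auto
qed

definition msupp :: "'v \<Rightarrow> 'a set" where
  "msupp v = (SOME M. supports M v \<and> card (stab v) \<le> d ^ d * card {\<sigma>. \<sigma> permutes X - M})"

lemma msupp:
  assumes "v \<in> V"
  shows "supports (msupp v) v" "card (stab v) \<le> d ^ d * card {\<sigma>. \<sigma> permutes X - msupp v}"
  using someI_ex[OF small_index_support[OF assms]] by (auto simp: msupp_def)

section \<open>Edge orbits and one step of the walk\<close>

definition orbit :: "'v set \<Rightarrow> 'v set set" where
  "orbit e = (\<lambda>\<sigma>. act \<sigma> ` e) ` {\<sigma>. \<sigma> permutes X}"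

text \<open>The counterpart of \<open>weighted_walk\<close> for an abstract action;
  \<open>walk_eq\<close> identifies the two for an FI-graph.\<close>

definition walk :: "'v \<Rightarrow> 'v pmf" where
  "walk v =
     bind_pmf (pmf_of_set {Orb \<in> orbit ` E. \<exists>e\<in>Orb. v \<in> e}) (\<lambda>Orb.
     bind_pmf (pmf_of_set {e \<in> Orb. v \<in> e}) (\<lambda>e.
     return_pmf (THE w. e = {v, w})))"

lemma orbit_refl: "e \<in> E \<Longrightarrow> e \<in> orbit e"
  using act_id_image[OF edge_subset, of e] by (force simp: orbit_def)

lemma orbit_subset: "e \<in> E \<Longrightarrow> orbit e \<subseteq> E"
  by (auto simp: orbit_def act_edge)

lemma orbit_act_subset:
  assumes "e \<in> E" "\<sigma> permutes X"
  shows "orbit (act \<sigma> ` e) \<subseteq> orbit e"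
  using assms edge_subset[OF assms(1)]
  by (auto simp: orbit_def simp flip: act_comp_image intro!: imageI permutes_compose)

lemma orbit_act:
  assumes "e \<in> E" "\<sigma> permutes X"
  shows "orbit (act \<sigma> ` e) = orbit e"
proof
  have "act (inv \<sigma>) ` act \<sigma> ` e = e"
    using act_comp_image[of "inv \<sigma>" \<sigma> e] assms edge_subset[OF assms(1)]
    by (simp add: permutes_inv permutes_inv_o act_id_image)
  then show "orbit e \<subseteq> orbit (act \<sigma> ` e)"
    using orbit_act_subset[of "act \<sigma> ` e" "inv \<sigma>"] assms by (simp add: act_edge permutes_inv)
qed (rule orbit_act_subset[OF assms])

text \<open>The type of an ordered pair of endpoints of a representative edge determines the orbit,
  since pairs of equal type are related by the action.\<close>

lemma card_orbits: "card (orbit ` E) \<le> R"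
proof -
  define rep where "rep Q = (SOME p. fst p \<in> V \<and> snd p \<in> V \<and> {fst p, snd p} \<in> E \<and> orbit {fst p, snd p} = Q)" for Q
  have rep: "fst (rep Q) \<in> V" "snd (rep Q) \<in> V" "{fst (rep Q), snd (rep Q)} \<in> E"
     "orbit {fst (rep Q), snd (rep Q)} = Q" if Q: "Q \<in> orbit ` E" for Q
  proof -
    obtain e where "e \<in> E" "Q = orbit e" using Q by auto
    moreover from this(1) obtain u v where "u \<in> V" "v \<in> V" "e = {u, v}" by (rule edgeE)
    ultimately have "\<exists>p. fst p \<in> V \<and> snd p \<in> V \<and> {fst p, snd p} \<in> E \<and> orbit {fst p, snd p} = Q"
      by (intro exI[of _ "(u, v)"]) simp
    from someI_ex[OF this] show "fst (rep Q) \<in> V" "snd (rep Q) \<in> V" "{fst (rep Q), snd (rep Q)} \<in> E"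
     "orbit {fst (rep Q), snd (rep Q)} = Q" by (auto simp: rep_def)
  qed
  have "inj_on (\<lambda>Q. ptype (rep Q)) (orbit ` E)"
  proof (rule inj_onI)
    fix Q Q' assume Q: "Q \<in> orbit ` E" "Q' \<in> orbit ` E" "ptype (rep Q) = ptype (rep Q')"
    have "(fst (rep Q), snd (rep Q)) \<in> V \<times> V" "(fst (rep Q'), snd (rep Q')) \<in> V \<times> V"
      using rep(1,2)[OF Q(1)] rep(1,2)[OF Q(2)] by blast+
    from ptype_eq[OF this] obtain \<sigma> where "\<sigma> permutes X"
      "act \<sigma> (fst (rep Q)) = fst (rep Q')" "act \<sigma> (snd (rep Q)) = snd (rep Q')"
      using Q(3) by auto
    then show "Q = Q'"
      using orbit_act[of "{fst (rep Q), snd (rep Q)}" \<sigma>] rep[OF Q(1)] rep[OF Q(2)] by simp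
  qed
  moreover have "(\<lambda>Q. ptype (rep Q)) ` orbit ` E \<subseteq> {..<R}"
    using rep by (force simp: mem_Times_iff intro!: ptype_less)
  ultimately show ?thesis using card_inj_on_le[of _ "orbit ` E" "{..<R}"] by auto
qed

definition incident_orbits :: "'v \<Rightarrow> 'v set set set" where
  "incident_orbits v = {Orb \<in> orbit ` E. \<exists>e\<in>Orb. v \<in> e}"

lemma finite_incident_orbits: "finite (incident_orbits v)"
  using finite_E by (simp add: incident_orbits_def)

lemma incident_orbitsD:
  assumes "Orb \<in> incident_orbits v"
  shows "Orb \<subseteq> E" "finite {e \<in> Orb. v \<in> e}" "{e \<in> Orb. v \<in> e} \<noteq> {}"
proof -
  show "Orb \<subseteq> E" using assms orbit_subset by (auto simp: incident_orbits_def)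
  then show "finite {e \<in> Orb. v \<in> e}" using finite_E finite_subset by fastforce
  show "{e \<in> Orb. v \<in> e} \<noteq> {}" using assms by (auto simp: incident_orbits_def)
qed

lemma incident_orbits_nonempty: "e \<in> E \<Longrightarrow> v \<in> e \<Longrightarrow> incident_orbits v \<noteq> {}"
  using orbit_refl by (fastforce simp: incident_orbits_def)

lemma set_pmf_walk:
  assumes "e \<in> E" "v \<in> e"
  shows "set_pmf (walk v) \<subseteq> V"
proof -
  have "(THE w. f = {v, w}) \<in> V" if f: "f \<in> E" "v \<in> f" for f
  proof -
    obtain w where "f = {v, w}" "w \<in> V"
      using f by (auto elim!: edgeE)
    then show ?thesis by (simp add: other_endpoint)
  qed
  then show ?thesis
    using incident_orbitsD incident_orbits_nonempty[OF assms] finite_incident_orbits[of v]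
    unfolding walk_def incident_orbits_def[symmetric]
    by (auto simp: set_pmf_of_set subset_iff)
qed

lemma expectation_walk:
  fixes \<phi> :: "'v \<Rightarrow> real"
  assumes "incident_orbits v \<noteq> {}"
  shows "measure_pmf.expectation (walk v) \<phi> =
    (\<Sum>Orb\<in>incident_orbits v. (\<Sum>e | e \<in> Orb \<and> v \<in> e. \<phi> (THE w. e = {v, w})) /
      card {e \<in> Orb. v \<in> e}) / card (incident_orbits v)"
proof -
  let ?N = "\<lambda>Orb. {e \<in> Orb. v \<in> e}"
  let ?W = "\<lambda>Orb. bind_pmf (pmf_of_set (?N Orb)) (\<lambda>e. return_pmf (THE w. e = {v, w}))"
  have fin: "finite (set_pmf (?W Orb))" if "Orb \<in> incident_orbits v" for Orb
    using incident_orbitsD[OF that] by (simp add: set_pmf_of_set)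
  have "measure_pmf.expectation (walk v) \<phi> =
    (\<Sum>Orb\<in>incident_orbits v. measure_pmf.expectation (?W Orb) \<phi> /\<^sub>R card (incident_orbits v))"
    unfolding walk_def incident_orbits_def[symmetric]
    by (rule pmf_expectation_bind_pmf_of_set[OF assms finite_incident_orbits fin])
  also have "\<dots> = (\<Sum>Orb\<in>incident_orbits v. measure_pmf.expectation (?W Orb) \<phi>) / card (incident_orbits v)"
    by (simp add: divide_inverse mult.commute flip: sum_distrib_left)
  also have "(\<Sum>Orb\<in>incident_orbits v. measure_pmf.expectation (?W Orb) \<phi>) =
    (\<Sum>Orb\<in>incident_orbits v. (\<Sum>e\<in>?N Orb. \<phi> (THE w. e = {v, w})) / card (?N Orb))"
    using incident_orbitsD
    by (intro sum.cong refl, subst pmf_expectation_bind_pmf_of_set)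
       (auto simp: divide_inverse mult.commute sum_distrib_left)
  finally show ?thesis .
qed

text \<open>At most \<open>R\<close> edge orbits meet a vertex, \<open>d ^ d\<close> bounds the index of the pointwise fixer of
  the support in the stabilizer, and an edge may be mapped to another one in two directions.\<close>

definition c :: real where "c = 1 / (2 * R * d ^ d)"

text \<open>If some \<open>\<rho>\<close> takes \<open>u\<close> to \<open>act \<sigma> v\<close>,
  then all such permutations form a coset of the stabilizer of \<open>u\<close>, which is conjugate
  to that of \<open>v\<close>.\<close>

lemma card_moving_le:
  assumes "v \<in> V" "u \<in> V" "\<sigma> permutes X"
  shows "card {\<tau>. \<tau> permutes X \<and> act \<tau> u = act \<sigma> v} \<le> card (stab v)"
proof (cases "\<exists>\<tau>. \<tau> permutes X \<and> act \<tau> u = act \<sigma> v")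
  case True
  then obtain \<rho> where \<rho>: "\<rho> permutes X" "act \<rho> u = act \<sigma> v" by auto
  note \<sigma> = assms(3)
  show ?thesis
  proof (rule card_inj_on_le)
    show "inj_on (\<lambda>\<tau>. inv \<sigma> \<circ> (\<tau> \<circ> (inv \<rho> \<circ> \<sigma>))) {\<tau>. \<tau> permutes X \<and> act \<tau> u = act \<sigma> v}"
      by (rule inj_onI) (simp add: permutes_comp_left_cancel[OF permutes_inv[OF \<sigma>]]
          permutes_comp_right_cancel[OF permutes_compose[OF \<sigma> permutes_inv[OF \<rho>(1)]]])
    have "act (inv \<rho>) (act \<sigma> v) = u" using act_inv(1)[OF \<rho>(1) assms(2)] \<rho>(2) by simp
    then show "(\<lambda>\<tau>. inv \<sigma> \<circ> (\<tau> \<circ> (inv \<rho> \<circ> \<sigma>))) ` {\<tau>. \<tau> permutes X \<and> act \<tau> u = act \<sigma> v} \<subseteq> stab v"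
      using assms \<rho>(1) by (auto simp: stab_def act_comp act_vertex act_inv permutes_inv permutes_compose)
  qed (rule finite_stab)
next
  case False
  then have "{\<tau>. \<tau> permutes X \<and> act \<tau> u = act \<sigma> v} = {}" by auto
  then show ?thesis by (metis card.empty le0)
qed

text \<open>With \<open>x = act \<sigma> v\<close>, the walk selects the orbit of
  \<open>{v, w}\<close> with probability at least \<open>1 / R\<close> and then one of the
  \<open>card N\<close> edges of that orbit at \<open>x\<close>. The images of \<open>{v, w}\<close>
  under \<open>\<sigma> \<circ> g\<close>, for \<open>g\<close> in \<open>F\<close>, are among these
  edges, each hit at most \<open>card D\<close> times, and orbit counting bounds
  \<open>card N * card D\<close> by a multiple of \<open>card F\<close>.\<close>

lemma one_step_bound:
  fixes \<phi> :: "'v \<Rightarrow> real"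
  assumes v: "v \<in> V" and w: "w \<in> V" and vw: "{v, w} \<in> E" and \<sigma>: "\<sigma> permutes X"
    and \<phi>: "\<And>z. 0 \<le> \<phi> z"
  shows "c * perm_avg (X - msupp v) (\<lambda>g. \<phi> (act (\<sigma> \<circ> g) w)) \<le>
    measure_pmf.expectation (walk (act \<sigma> v)) \<phi>"
proof -
  define x where "x = act \<sigma> v"
  define Orb where "Orb = orbit {v, w}"
  define N where "N = {e \<in> Orb. x \<in> e}"
  define F where "F = {g. g permutes X - msupp v}"
  define D where "D = stab v \<inter> stab w"
  define oth where "oth e = (THE u. e = {x, u})" for e
  have "act \<sigma> ` {v, w} \<in> Orb" using \<sigma> by (auto simp: Orb_def orbit_def)
  then have Orb: "Orb \<in> incident_orbits x"
    using vw by (auto simp: incident_orbits_def x_def Orb_def)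
  have finN: "finite N" and N0: "card N > 0"
    using incident_orbitsD[OF Orb] by (auto simp: N_def card_gt_0_iff)
  have finF: "finite F" using finite_X by (simp add: F_def finite_permutations)
  have cF: "card F = fact (card (X - msupp v))"
    unfolding F_def using finite_X by (intro card_permutations) auto
  have finD: "finite D" using finite_stab by (simp add: D_def)
  have F: "g permutes X" "act g v = v" if "g \<in> F" for g
    using that msupp(1)[OF v] permutes_X by (auto simp: F_def supports_def)
  define m where "m g = act (\<sigma> \<circ> g) ` {v, w}" for g
  have m: "m g = {x, act (\<sigma> \<circ> g) w}" "m g \<in> N" if "g \<in> F" for g
  proof -
    show 1: "m g = {x, act (\<sigma> \<circ> g) w}"
      using F[OF that] \<sigma> v by (simp add: m_def act_comp x_def)
    have "m g \<in> Orb" using F[OF that] \<sigma> by (auto simp: Orb_def orbit_def m_def intro: permutes_compose)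
    then show "m g \<in> N" using 1 by (simp add: N_def)
  qed
  have oth: "oth (m g) = act (\<sigma> \<circ> g) w" if "g \<in> F" for g
    unfolding oth_def m(1)[OF that] by (rule other_endpoint)
  \<comment> \<open>All \<open>g\<close> in \<open>F\<close> fix \<open>v\<close>, so equal edges
    have equal other endpoints and \<open>inv g0 \<circ> g\<close> fixes both \<open>v\<close> and
    \<open>w\<close>.\<close>
  have fibre: "card {g \<in> F. m g = e} \<le> card D" for e
  proof (cases "\<exists>g. g \<in> F \<and> m g = e")
    case True
    then obtain g0 where g0: "g0 \<in> F" "m g0 = e" by auto
    show ?thesis
    proof (rule card_inj_on_le[of "\<lambda>g. inv g0 \<circ> g"])
      show "inj_on (\<lambda>g. inv g0 \<circ> g) {g \<in> F. m g = e}"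
        by (rule inj_onI) (simp add: permutes_comp_left_cancel[OF permutes_inv[OF F(1)[OF g0(1)]]])
      show "(\<lambda>g. inv g0 \<circ> g) ` {g \<in> F. m g = e} \<subseteq> D"
      proof clarify
        fix g assume g: "g \<in> F" "e = m g"
        have "act (\<sigma> \<circ> g) w = act (\<sigma> \<circ> g0) w"
          using oth[OF g(1)] oth[OF g0(1)] g(2) g0(2) by simp
        then have "act \<sigma> (act g w) = act \<sigma> (act g0 w)"
          using \<sigma> F(1)[OF g(1)] F(1)[OF g0(1)] w by (simp add: act_comp)
        then have "act g w = act g0 w"
          using \<sigma> F(1)[OF g(1)] F(1)[OF g0(1)] w by (simp add: act_inj act_vertex)
        then show "inv g0 \<circ> g \<in> D"
          using F[OF g0(1)] F[OF g(1)] v w act_inv(1)[of g0 v] act_inv(1)[of g0 w]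
          by (simp add: D_def stab_def act_comp permutes_inv permutes_compose)
      qed
    qed (rule finD)
  next
    case False
    then have "{g \<in> F. m g = e} = {}" by auto
    then show ?thesis by (metis card.empty le0)
  qed
  have 1: "(\<Sum>g\<in>F. \<phi> (act (\<sigma> \<circ> g) w)) \<le> card D * (\<Sum>e\<in>N. \<phi> (oth e))"
  proof -
    have "(\<Sum>g\<in>F. \<phi> (act (\<sigma> \<circ> g) w)) = (\<Sum>g\<in>F. \<phi> (oth (m g)))"
      using oth by (intro sum.cong) auto
    also have "\<dots> = (\<Sum>e\<in>N. \<Sum>g | g \<in> F \<and> m g = e. \<phi> (oth (m g)))"
      using finF finN m(2) by (intro sum.group[symmetric]) auto
    also have "\<dots> = (\<Sum>e\<in>N. \<Sum>g | g \<in> F \<and> m g = e. \<phi> (oth e))"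
      by (intro sum.cong refl) blast
    also have "\<dots> = (\<Sum>e\<in>N. card {g \<in> F. m g = e} * \<phi> (oth e))"
      by simp
    also have "\<dots> \<le> (\<Sum>e\<in>N. card D * \<phi> (oth e))"
      using fibre \<phi> by (intro sum_mono mult_right_mono) auto
    finally show ?thesis by (simp add: sum_distrib_left)
  qed
  let ?T = "{\<tau>. \<tau> permutes X \<and> x \<in> act \<tau> ` {v, w}}"
  \<comment> \<open>Elements of \<open>D\<close> preserve \<open>{v, w}\<close>, so composing a
    permutation that takes \<open>{v, w}\<close> to \<open>e\<close> with one of them still gives
    \<open>e\<close>. Distinct pairs therefore give distinct permutations that put \<open>x\<close>
    on the image of \<open>{v, w}\<close>.\<close>
  have 2: "card N * card D \<le> card ?T"
  proof -
    define rep where "rep e = (SOME \<tau>. \<tau> permutes X \<and> e = act \<tau> ` {v, w})" for e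
    have rep: "rep e permutes X" "act (rep e) ` {v, w} = e" if "e \<in> N" for e
    proof -
      have "\<exists>\<tau>. \<tau> permutes X \<and> e = act \<tau> ` {v, w}"
        using that by (auto simp: N_def Orb_def orbit_def)
      from someI_ex[OF this] show "rep e permutes X" "act (rep e) ` {v, w} = e"
        by (auto simp: rep_def)
    qed
    have D: "\<delta> permutes X" "act \<delta> ` {v, w} = {v, w}" if "\<delta> \<in> D" for \<delta>
      using that by (auto simp: D_def stab_def)
    have img: "act (rep e \<circ> \<delta>) ` {v, w} = e" if "e \<in> N" "\<delta> \<in> D" for e \<delta>
      using D[OF that(2)] rep[OF that(1)] v w by (subst act_comp_image) auto
    have "card (N \<times> D) \<le> card ?T"
    proof (rule card_inj_on_le[of "\<lambda>(e, \<delta>). rep e \<circ> \<delta>"])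
      show "inj_on (\<lambda>(e, \<delta>). rep e \<circ> \<delta>) (N \<times> D)"
      proof (rule inj_onI, clarify)
        fix e \<delta> e' \<delta>' assume *: "e \<in> N" "\<delta> \<in> D" "e' \<in> N" "\<delta>' \<in> D" "rep e \<circ> \<delta> = rep e' \<circ> \<delta>'"
        then have "e = e'" using img[of e \<delta>] img[of e' \<delta>'] by simp
        with * show "e = e' \<and> \<delta> = \<delta>'"
          by (simp add: permutes_comp_left_cancel[OF rep(1)])
      qed
      show "(\<lambda>(e, \<delta>). rep e \<circ> \<delta>) ` (N \<times> D) \<subseteq> ?T"
      proof clarify
        fix e \<delta> assume e: "e \<in> N" "\<delta> \<in> D"
        have "rep e \<circ> \<delta> permutes X" using rep(1)[OF e(1)] D(1)[OF e(2)] by (intro permutes_compose)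
        moreover have "x \<in> e" using e(1) by (simp add: N_def)
        ultimately show "rep e \<circ> \<delta> permutes X \<and> x \<in> act (rep e \<circ> \<delta>) ` {v, w}"
          unfolding img[OF e] by blast
      qed
      show "finite ?T" using finite_permutations[OF finite_X] by (rule rev_finite_subset) auto
    qed
    then show ?thesis by (simp add: card_cartesian_product)
  qed
  \<comment> \<open>Either \<open>v\<close> or \<open>w\<close> is sent to \<open>x\<close>; both
    cases are bounded by the stabilizer of \<open>v\<close>.\<close>
  have "?T \<subseteq> {\<tau>. \<tau> permutes X \<and> act \<tau> v = act \<sigma> v} \<union> {\<tau>. \<tau> permutes X \<and> act \<tau> w = act \<sigma> v}"
    by (auto simp: x_def)
  then have "card ?T \<le> card ({\<tau>. \<tau> permutes X \<and> act \<tau> v = act \<sigma> v} \<union> {\<tau>. \<tau> permutes X \<and> act \<tau> w = act \<sigma> v})"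
    using finite_permutations[OF finite_X] by (intro card_mono finite_UnI; auto elim!: rev_finite_subset)
  also have "\<dots> \<le> card (stab v) + card (stab v)"
    using card_moving_le[OF v v \<sigma>] card_moving_le[OF v w \<sigma>]
    by (intro order_trans[OF card_Un_le] add_mono)
  also have "\<dots> \<le> 2 * (d ^ d * card F)"
    using msupp(2)[OF v] by (simp add: F_def)
  finally have 3: "card N * card D \<le> 2 * (d ^ d * card F)" using 2 by linarith
  have D0: "card D > 0" using finD stab_id[OF v] stab_id[OF w] by (auto simp: D_def card_gt_0_iff)
  have F0: "card F > 0" by (simp add: cF)
  have dd: "real d ^ d > 0" by (cases "d = 0") auto
  let ?S = "\<Sum>e\<in>N. \<phi> (oth e)"
  have S: "?S \<ge> 0" using \<phi> by (intro sum_nonneg) auto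
  have I: "card (incident_orbits x) > 0" "card (incident_orbits x) \<le> R"
    using Orb finite_incident_orbits card_mono[of "orbit ` E" "incident_orbits x"] finite_E card_orbits
    by (auto simp: card_gt_0_iff incident_orbits_def)
  then have R: "R > 0" by simp
  have "perm_avg (X - msupp v) (\<lambda>g. \<phi> (act (\<sigma> \<circ> g) w)) = (\<Sum>g\<in>F. \<phi> (act (\<sigma> \<circ> g) w)) / card F"
    by (simp add: perm_avg_def cF) (simp add: F_def)
  also have "\<dots> \<le> card D * ?S / card F"
    using 1 by (intro divide_right_mono) auto
  also have "\<dots> \<le> (2 * d ^ d / card N) * ?S"
  proof -
    have "real (card N) * card D \<le> 2 * (d ^ d * card F)"
      using 3 by (metis of_nat_le_iff of_nat_mult of_nat_numeral of_nat_power)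
    then have "real (card D) / card F \<le> 2 * d ^ d / card N"
      using N0 F0 by (simp add: divide_simps algebra_simps)
    from mult_right_mono[OF this S] show ?thesis by simp
  qed
  finally have "c * perm_avg (X - msupp v) (\<lambda>g. \<phi> (act (\<sigma> \<circ> g) w)) \<le> c * ((2 * d ^ d / card N) * ?S)"
    by (intro mult_left_mono) (auto simp: c_def)
  also have "\<dots> = (?S / card N) / R"
    using R dd by (simp add: c_def divide_simps)
  \<comment> \<open>At most \<open>R\<close> orbits meet \<open>x\<close>; afterwards the
    contributions of the other orbits, all nonnegative, are added.\<close>
  also have "\<dots> \<le> (?S / card N) / card (incident_orbits x)"
    using I S R by (intro divide_left_mono) auto
  also have "\<dots> \<le> (\<Sum>Orb\<in>incident_orbits x. (\<Sum>e | e \<in> Orb \<and> x \<in> e. \<phi> (oth e)) /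
      card {e \<in> Orb. x \<in> e}) / card (incident_orbits x)"
    unfolding N_def using \<phi>
    by (intro divide_right_mono member_le_sum[of Orb] Orb finite_incident_orbits
        divide_nonneg_nonneg sum_nonneg) auto
  also have "\<dots> = measure_pmf.expectation (walk x) \<phi>"
    using Orb by (subst expectation_walk) (auto simp: oth_def)
  finally show ?thesis by (simp add: x_def)
qed

lemma c_bounds: "R > 0 \<Longrightarrow> 0 < c" "c \<le> 1"
proof -
  have dd: "1 \<le> real d ^ d" by (cases "d = 0") auto
  then have "0 < real d ^ d" by linarith
  then show "0 < c" if "R > 0" unfolding c_def using that by (intro divide_pos_pos mult_pos_pos) auto
  show "c \<le> 1"
  proof (cases "R = 0")
    case False
    then have "1 * 1 \<le> (2 * real R) * real d ^ d" using dd by (intro mult_mono) auto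
    then show ?thesis by (simp add: c_def divide_simps)
  next
    \<comment> \<open>Division by zero makes \<open>c = 0\<close>.\<close>
    case True
    then show ?thesis unfolding c_def by simp
  qed
qed

end

text \<open>\<open>very_large\<close> makes the total error \<open>4 * R * \<eta>\<close> of two
  minorizations at most half of the main term \<open>c ^ (2 * R)\<close>.\<close>

locale mixing_perm_graph = perm_graph +
  assumes connected: "graph_connected V E" and not_bipartite: "\<not> graph_bipartite V E"
    and very_large: "8 * R * \<eta> \<le> c ^ (2 * R)"
begin

section \<open>The walk as a chain on the vertex set\<close>

definition adj :: "('b \<times> 'b) set" where "adj = {(u, v). {u, v} \<in> E}"

lemma adjD: "(u, v) \<in> adj \<Longrightarrow> u \<in> V \<and> v \<in> V"
  using edge_subset by (fastforce simp: adj_def)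

lemma adj_sym: "(u, v) \<in> adj \<Longrightarrow> (v, u) \<in> adj"
  by (simp add: adj_def insert_commute)

lemma V_nonempty: "V \<noteq> {}"
proof
  assume "V = {}"
  then have "E = {}" using edgeE by blast
  with \<open>V = {}\<close> have "graph_bipartite V E" by (auto simp: graph_bipartite_def)
  with not_bipartite show False ..
qed

text \<open>A vertex without neighbours would be the only vertex of the connected graph, which then
  has no edges and is bipartite with one empty side. A loop makes a vertex its own
  neighbour.\<close>

lemma has_neighbour:
  assumes v: "v \<in> V"
  shows "\<exists>w. (v, w) \<in> adj"
proof (rule ccontr)
  assume *: "\<nexists>w. (v, w) \<in> adj"
  have "u = v" if "u \<in> V" for u
  proof -
    have "(v, u) \<in> adj\<^sup>*" using connected v that by (auto simp: graph_connected_def adj_def)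
    then show ?thesis using * by (metis converse_rtranclE)
  qed
  then have V: "V = {v}" using v by blast
  have "E = {}"
  proof (rule equals0I)
    fix e assume "e \<in> E"
    then obtain u w where "u \<in> V" "w \<in> V" "e = {u, w}" by (rule edgeE)
    with V \<open>e \<in> E\<close> have "(v, v) \<in> adj" by (simp add: adj_def)
    with * show False by blast
  qed
  with V have "graph_bipartite V E"
    unfolding graph_bipartite_def by (intro exI[of _ V] exI[of _ "{}"]) auto
  with not_bipartite show False ..
qed

sublocale finite_chain V walk
proof
  fix v assume "v \<in> V"
  then obtain w where "{v, w} \<in> E" using has_neighbour by (auto simp: adj_def)
  then show "set_pmf (walk v) \<subseteq> V" by (rule set_pmf_walk) simp
qed (use finite_V V_nonempty in auto)

text \<open>Induction on the last step: \<open>one_step_bound\<close> contributes a factor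
  \<open>c\<close> and a permutation fixing the support of the current vertex, and
  \<open>perm_avg_compose\<close> merges it with the permutation accumulated so far, at a cost of at
  most \<open>\<eta>\<close>. There are \<open>t + 1\<close> steps but only \<open>t\<close>
  mergers.\<close>

lemma iterated_bound:
  fixes \<phi> :: "'b \<Rightarrow> real"
  assumes path: "\<And>i. i \<le> t \<Longrightarrow> (x i, x (Suc i)) \<in> adj"
    and \<phi>: "\<And>z. 0 \<le> \<phi> z" "\<And>z. \<phi> z \<le> 1"
  shows "c ^ Suc t * perm_avg (X - (\<Inter>i\<le>t. msupp (x i))) (\<lambda>\<sigma>. \<phi> (act \<sigma> (x (Suc t)))) - t * \<eta> \<le>
    measure_pmf.expectation (step_dist walk (Suc t) (x 0)) \<phi>"
  using path \<phi>
proof (induction t arbitrary: \<phi>)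
  case 0
  then have "(x 0, x 1) \<in> adj" by auto
  then show ?case
    using one_step_bound[of "x 0" "x 1" id \<phi>] 0(2) adjD
    by (simp add: step_dist_Suc step_dist_0 bind_return_pmf act_id adj_def permutes_id)
next
  case (Suc t)
  let ?A = "\<Inter>i\<le>t. msupp (x i)" and ?B = "msupp (x (Suc t))"
  let ?\<psi> = "\<lambda>z. measure_pmf.expectation (walk z) \<phi>"
  let ?f = "\<lambda>\<sigma>. \<phi> (act \<sigma> (x (Suc (Suc t))))"
  have adj: "(x (Suc t), x (Suc (Suc t))) \<in> adj" "(x 0, x 1) \<in> adj" using Suc.prems(1) by auto
  then have V: "x 0 \<in> V" "x (Suc t) \<in> V" "x (Suc (Suc t)) \<in> V" using adjD by blast+
  have B: "?B \<subseteq> X" "card ?B \<le> d" "?A \<subseteq> msupp (x 0)" "msupp (x 0) \<subseteq> X" "card (msupp (x 0)) \<le> d"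
    using msupp(1)[OF V(1)] msupp(1)[OF V(2)] by (auto simp: supports_def)
  then have A: "?A \<subseteq> X" "card ?A \<le> d"
    using card_mono[OF finite_subset[OF B(4) finite_X] B(3)] by auto
  have AB: "?A \<inter> ?B = (\<Inter>i\<le>Suc t. msupp (x i))"
    by (auto simp: le_Suc_eq)
  have c0: "0 \<le> c" by (simp add: c_def)
  have "c ^ Suc (Suc t) * perm_avg (X - ?A \<inter> ?B) ?f - Suc t * \<eta> \<le>
      c ^ Suc (Suc t) * (perm_avg (X - ?A \<inter> ?B) ?f - \<eta>) - t * \<eta>"
    using mult_right_mono[OF power_le_one[OF c0 c_bounds(2), of "Suc (Suc t)"] \<eta>_bounds(1)]
    by (simp add: algebra_simps)
  also have "\<dots> \<le> c ^ Suc (Suc t) * perm_avg (X - ?A) (\<lambda>\<sigma>. perm_avg (X - ?B) (\<lambda>g. ?f (\<sigma> \<circ> g))) - t * \<eta>"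
    using perm_avg_compose[OF finite_X A(1) B(1) A(2) B(2) d_less, of ?f] Suc.prems c0
    by (intro diff_right_mono mult_left_mono) (auto simp: \<eta>_def)
  also have "\<dots> = c ^ Suc t * perm_avg (X - ?A) (\<lambda>\<sigma>. c * perm_avg (X - ?B) (\<lambda>g. ?f (\<sigma> \<circ> g))) - t * \<eta>"
    by (simp add: perm_avg_mult)
  also have "\<dots> \<le> c ^ Suc t * perm_avg (X - ?A) (\<lambda>\<sigma>. ?\<psi> (act \<sigma> (x (Suc t)))) - t * \<eta>"
    using one_step_bound[OF V(2,3)] adj(1) Suc.prems(2) c0
    by (intro diff_right_mono mult_left_mono perm_avg_mono) (auto simp: adj_def permutes_X)
  also have "\<dots> \<le> measure_pmf.expectation (step_dist walk (Suc t) (x 0)) ?\<psi>"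
    using Suc.prems(1) expectation_in_unit[of \<phi>, OF Suc.prems(2,3)] by (intro Suc.IH) auto
  also have "\<dots> = measure_pmf.expectation (step_dist walk (Suc (Suc t)) (x 0)) \<phi>"
    unfolding step_dist_Suc[of _ "Suc t"] using set_step_dist[OF V(1)] closed
    by (intro expectation_bind[symmetric]) auto
  finally show ?case unfolding AB .
qed

text \<open>A permutation fixing \<open>S\<close> pointwise does not move the endpoint, so it can be
  averaged in for free; one more merger then replaces the fixed set by its intersection with
  \<open>S\<close>, which is empty. \<open>S\<close> is an arbitrary support because
  \<open>msupp\<close> of a translate need not be the translate of \<open>msupp\<close>.\<close>

lemma disjoint_support_bound:
  fixes \<phi> :: "'b \<Rightarrow> real"
  assumes path: "\<And>i. i \<le> t \<Longrightarrow> (x i, x (Suc i)) \<in> adj"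
    and S: "supports S (x (Suc t))" "msupp (x 0) \<inter> S = {}"
    and \<phi>: "\<And>z. 0 \<le> \<phi> z" "\<And>z. \<phi> z \<le> 1"
  shows "c ^ Suc t * perm_avg X (\<lambda>\<sigma>. \<phi> (act \<sigma> (x (Suc t)))) - Suc t * \<eta> \<le>
    measure_pmf.expectation (step_dist walk (Suc t) (x 0)) \<phi>"
proof -
  let ?A = "\<Inter>i\<le>t. msupp (x i)"
  let ?f = "\<lambda>\<sigma>. \<phi> (act \<sigma> (x (Suc t)))"
  have V: "x 0 \<in> V" "x (Suc t) \<in> V" using path[of 0] path[of t] adjD by blast+
  have sub: "?A \<subseteq> msupp (x 0)" by auto
  have A: "?A \<subseteq> X" "card ?A \<le> d"
    using msupp(1)[OF V(1)] sub card_mono[OF _ sub] finite_subset[OF _ finite_X]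
    by (auto simp: supports_def intro: order_trans)
  have S': "S \<subseteq> X" "card S \<le> d" using S(1) by (auto simp: supports_def)
  have AS: "?A \<inter> S = {}" using sub S(2) by blast
  have c0: "0 \<le> c" by (simp add: c_def)
  have "c ^ Suc t * perm_avg X ?f - Suc t * \<eta> \<le> c ^ Suc t * (perm_avg X ?f - \<eta>) - t * \<eta>"
    using mult_right_mono[OF power_le_one[OF c0 c_bounds(2), of "Suc t"] \<eta>_bounds(1)]
    by (simp add: algebra_simps)
  also have "\<dots> \<le> c ^ Suc t * perm_avg (X - ?A) (\<lambda>\<sigma>. perm_avg (X - S) (\<lambda>g. ?f (\<sigma> \<circ> g))) - t * \<eta>"
    using perm_avg_compose[OF finite_X A(1) S'(1) A(2) S'(2) d_less, of ?f] \<phi> c0 AS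
    by (intro diff_right_mono mult_left_mono) (auto simp: \<eta>_def)
  also have "perm_avg (X - ?A) (\<lambda>\<sigma>. perm_avg (X - S) (\<lambda>g. ?f (\<sigma> \<circ> g))) =
      perm_avg (X - ?A) (\<lambda>\<sigma>. perm_avg (X - S) (\<lambda>g. ?f \<sigma>))"
    using S(1) V by (intro perm_avg_cong) (auto simp: act_comp permutes_X supports_def)
  also have "\<dots> = perm_avg (X - ?A) ?f"
    using finite_X by (simp add: perm_avg_const)
  finally show ?thesis using iterated_bound[of t x \<phi>, OF path \<phi>] by linarith
qed

section \<open>Walks of even length in a non-bipartite graph\<close>

abbreviation adj2 :: "('b \<times> 'b) set" where "adj2 \<equiv> adj O adj"

lemma adj2_sym: "(u, v) \<in> adj2\<^sup>* \<Longrightarrow> (v, u) \<in> adj2\<^sup>*"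
proof -
  have "sym adj2" by (rule symI) (auto intro: adj_sym)
  then show "(u, v) \<in> adj2\<^sup>* \<Longrightarrow> (v, u) \<in> adj2\<^sup>*" using sym_rtrancl by (meson symD)
qed

lemma adj2_rtrancl_shift:
  assumes "(v, w) \<in> adj2\<^sup>*"
  shows "(u, v) \<in> adj \<Longrightarrow> (w, z) \<in> adj \<Longrightarrow> (u, z) \<in> adj2\<^sup>*"
  using assms
proof (induction arbitrary: z rule: rtrancl_induct)
  case base
  then show ?case by blast
next
  case (step y w)
  then obtain m where "(y, m) \<in> adj" "(m, w) \<in> adj" by auto
  with step have "(u, m) \<in> adj2\<^sup>*" "(m, z) \<in> adj2" by auto
  then show ?case by (rule rtrancl_into_rtrancl)
qed

lemma even_or_odd: "(u, v) \<in> adj\<^sup>* \<Longrightarrow> (u, v) \<in> adj2\<^sup>* \<or> (\<exists>w. (u, w) \<in> adj2\<^sup>* \<and> (w, v) \<in> adj)"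
proof (induction rule: rtrancl_induct)
  case base
  then show ?case by blast
next
  case (step y z)
  then show ?case by (meson relcomp.relcompI rtrancl_into_rtrancl)
qed

text \<open>Otherwise the vertices reached from \<open>u\<close> by even walks and the remaining
  ones form a bipartition: an edge inside the first class would change the parity and reach
  \<open>v\<close>, and an edge inside the second would make one of its ends reachable by an even
  walk.\<close>

lemma even_walk_exists:
  assumes "u \<in> V" "v \<in> V"
  shows "(u, v) \<in> adj2\<^sup>*"
proof (rule ccontr)
  assume uv: "(u, v) \<notin> adj2\<^sup>*"
  have conn: "(u, w) \<in> adj2\<^sup>* \<or> (\<exists>z. (u, z) \<in> adj2\<^sup>* \<and> (z, w) \<in> adj)" if "w \<in> V" for w
    using connected assms(1) that by (intro even_or_odd) (auto simp: graph_connected_def adj_def)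
  define A where "A = {w \<in> V. (u, w) \<in> adj2\<^sup>*}"
  have "\<exists>a\<in>A. \<exists>b\<in>V - A. e = {a, b}" if e: "e \<in> E" for e
  proof -
    obtain a b where ab: "a \<in> V" "b \<in> V" "e = {a, b}" using e by (rule edgeE)
    then have adj: "(a, b) \<in> adj" "(b, a) \<in> adj" using e by (auto simp: adj_def insert_commute)
    consider "a \<in> A" "b \<in> A" | "a \<notin> A" "b \<notin> A" | "a \<in> A" "b \<notin> A" | "a \<notin> A" "b \<in> A" by blast
    then show ?thesis
    proof cases
      case 1
      then have au: "(u, a) \<in> adj2\<^sup>*" and bu: "(b, u) \<in> adj2\<^sup>*"
        by (simp_all add: A_def adj2_sym)
      obtain z where z: "(u, z) \<in> adj2\<^sup>*" "(z, v) \<in> adj" using conn[OF assms(2)] uv by blast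
      have "(a, v) \<in> adj2\<^sup>*"
        by (rule adj2_rtrancl_shift[OF rtrancl_trans[OF bu z(1)] adj(1) z(2)])
      with au have "(u, v) \<in> adj2\<^sup>*" by (rule rtrancl_trans)
      with uv show ?thesis ..
    next
      case 2
      then obtain z where "(u, z) \<in> adj2\<^sup>*" "(z, a) \<in> adj"
        using conn[OF ab(1)] ab(1) by (auto simp: A_def)
      then have "(u, b) \<in> adj2\<^sup>*" using adj(1) by (meson relcomp.relcompI rtrancl_into_rtrancl)
      then show ?thesis using 2 ab(2) by (simp add: A_def)
    next
      case 3
      then show ?thesis using ab by blast
    next
      case 4
      then show ?thesis using ab by (metis DiffI insert_commute)
    qed
  qed
  then have "graph_bipartite V E"
    unfolding graph_bipartite_def by (intro exI[of _ A] exI[of _ "V - A"]) (auto simp: A_def)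
  with not_bipartite show False ..
qed

lemma adj_act:
  assumes "\<sigma> permutes X" "(u, v) \<in> adj"
  shows "(act \<sigma> u, act \<sigma> v) \<in> adj"
  using act_edge[of \<sigma> "{u, v}"] assms by (simp add: adj_def)

lemma adj2_relpow_act:
  assumes "\<sigma> permutes X" "(u, v) \<in> adj2 ^^ n"
  shows "(act \<sigma> u, act \<sigma> v) \<in> adj2 ^^ n"
  using assms(2) by (induction n arbitrary: v) (auto intro: adj_act[OF assms(1)])

text \<open>The sets of types of pairs joined by a walk of length \<open>2 * n\<close> increase with \<open>n\<close>, so they
  are stable from \<open>n = R\<close> on.\<close>

lemma exact_walk:
  assumes "u \<in> V" "v \<in> V"
  shows "(u, v) \<in> adj ^^ (2 * R)"
proof -
  define Q where "Q n = adj2 ^^ n \<inter> V \<times> V" for n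
  define T where "T n = ptype ` Q n" for n
  \<comment> \<open>Stepping along an edge at \<open>b\<close> and back prolongs a walk by
    two.\<close>
  have Q_mono: "Q n \<subseteq> Q (Suc n)" for n
  proof clarify
    fix a b assume ab: "(a, b) \<in> Q n"
    then obtain w where "(b, w) \<in> adj" using has_neighbour by (auto simp: Q_def)
    then have "(b, b) \<in> adj2" using adj_sym by blast
    with ab show "(a, b) \<in> Q (Suc n)" by (auto simp: Q_def)
  qed
  \<comment> \<open>By symmetry \<open>Q n\<close> is a union of full type classes, so
    \<open>T n\<close> determines it and equality of type sets gives equality of relations.\<close>
  have Q_T: "(a, b) \<in> Q n" if ab: "a \<in> V" "b \<in> V" "ptype (a, b) \<in> T n" for a b n
  proof -
    obtain a' b' where *: "(a', b') \<in> Q n" "ptype (a, b) = ptype (a', b')"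
      using ab(3) by (auto simp: T_def)
    then obtain \<sigma> where "\<sigma> permutes X" "act \<sigma> a' = a" "act \<sigma> b' = b"
      using ptype_eq[of a' b' a b] ab by (auto simp: Q_def)
    with * ab show ?thesis using adj2_relpow_act[of \<sigma> a' b' n] by (auto simp: Q_def)
  qed
  have stable: "T (Suc n) = T (Suc (Suc n))" if eq: "T n = T (Suc n)" for n
  proof -
    have "Q (Suc n) \<subseteq> Q n"
    proof clarify
      fix a b assume ab: "(a, b) \<in> Q (Suc n)"
      then have "ptype (a, b) \<in> T (Suc n)" unfolding T_def by (rule imageI)
      then have "ptype (a, b) \<in> T n" by (simp only: eq)
      with ab show "(a, b) \<in> Q n" by (intro Q_T) (simp_all add: Q_def)
    qed
    with Q_mono have "Q n = Q (Suc n)" by blast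
    moreover have "Q (Suc n) = Q n O adj2" for n
      using adjD by (auto simp: Q_def)
    ultimately have "Q (Suc n) = Q (Suc (Suc n))" by metis
    then show ?thesis by (simp add: T_def)
  qed
  have "range T \<subseteq> Pow {..<R}" using ptype_less by (auto simp: T_def Q_def)
  then have "finite (range T)" by (rule finite_subset) simp
  moreover have "mono T"
    by (rule monoI, rule lift_Suc_mono_le) (use Q_mono in \<open>auto simp: T_def\<close>)
  ultimately have "\<exists>N. (\<forall>n\<le>N. \<forall>m\<le>N. m < n \<longrightarrow> T m \<subset> T n) \<and> (\<forall>n\<ge>N. T N = T n)"
    using stable by (intro finite_mono_remains_stable_implies_strict_prefix) auto
  then have "T (card {..<R}) = (\<Union>n. T n)"
    using ptype_less by (intro finite_mono_strict_prefix_implies_finite_fixpoint)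
      (auto simp: T_def Q_def)
  then have union: "T R = (\<Union>n. T n)" by simp
  obtain n where "(u, v) \<in> adj2 ^^ n"
    using even_walk_exists[OF assms] rtrancl_power by blast
  then have "ptype (u, v) \<in> T n" using assms by (auto simp: T_def Q_def)
  then have "ptype (u, v) \<in> T R" using union by blast
  then have "(u, v) \<in> adj2 ^^ R" using Q_T[OF assms] by (auto simp: Q_def)
  moreover have "adj2 ^^ n = adj ^^ (2 * n)" for n
    by (induction n) (simp_all add: O_assoc)
  ultimately show ?thesis by (simp only:)
qed

section \<open>Minorization and contraction after \<open>2 * R\<close> steps\<close>

lemma disjoint_translate:
  assumes x: "x \<in> V" and y: "y \<in> V"
  obtains \<tau> where "\<tau> permutes X" "msupp x \<inter> \<tau> ` msupp y = {}"
proof -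
  have sub: "msupp x \<subseteq> X" "card (msupp x) \<le> d" "msupp y \<subseteq> X" "card (msupp y) \<le> d"
    using msupp(1)[OF x] msupp(1)[OF y] by (auto simp: supports_def)
  have fin: "finite (msupp x)" "finite (msupp y)" using sub finite_subset[OF _ finite_X] by auto
  \<comment> \<open>More than \<open>2 * d\<^sup>2\<close> points lie outside the support of
    \<open>x\<close>, and this is at least \<open>d\<close>, so there is room for the support of
    \<open>y\<close>.\<close>
  have "d \<le> 2 * d\<^sup>2" by (simp add: power2_eq_square)
  then have "card (msupp y) \<le> card (X - msupp x)"
    using sub large card_Diff_subset[OF fin(1) sub(1)] by linarith
  then obtain h where h: "inj_on h (msupp y)" "h ` msupp y \<subseteq> X - msupp x"
    using inj_on_iff_card_le[OF fin(2)] finite_X by blast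
  have "h ` msupp y \<subseteq> X" using h(2) by blast
  with h(1) obtain \<tau> where \<tau>: "\<tau> permutes X" "\<And>i. i \<in> msupp y \<Longrightarrow> \<tau> i = h i"
    using extend_to_permutation[OF finite_X sub(3), of h] by blast
  have "\<tau> ` msupp y = h ` msupp y" by (intro image_cong \<tau>(2)) auto
  then have "msupp x \<inter> \<tau> ` msupp y = {}" using h(2) by auto
  with \<tau>(1) show thesis by (rule that)
qed

lemma R_pos: "R > 0"
  using V_nonempty ptype_less by fastforce

text \<open>The walk of length \<open>2 * R\<close> is aimed at a translate
  \<open>act \<tau> y\<close> with a support disjoint from that of \<open>x\<close>. Translating
  \<open>y\<close> does not change the average over all permutations, so the lower bound is the same
  for every \<open>x\<close>.\<close>

lemma minorization:
  fixes \<phi> :: "'b \<Rightarrow> real"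
  assumes x: "x \<in> V" and y: "y \<in> V" and \<phi>: "\<And>z. 0 \<le> \<phi> z" "\<And>z. \<phi> z \<le> 1"
  shows "c ^ (2 * R) * perm_avg X (\<lambda>\<sigma>. \<phi> (act \<sigma> y)) - 2 * R * \<eta> \<le>
    measure_pmf.expectation (step_dist walk (2 * R) x) \<phi>"
proof -
  obtain \<tau> where \<tau>: "\<tau> permutes X" "msupp x \<inter> \<tau> ` msupp y = {}"
    using disjoint_translate[OF x y] .
  have "(x, act \<tau> y) \<in> adj ^^ (2 * R)"
    using x y \<tau>(1) by (intro exact_walk act_vertex)
  then obtain f where f: "f 0 = x" "f (2 * R) = act \<tau> y" "\<And>i. i < 2 * R \<Longrightarrow> (f i, f (Suc i)) \<in> adj"
    unfolding relpow_fun_conv by blast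
  obtain t where t: "2 * R = Suc t" using R_pos by (cases "2 * R") auto
  have "c ^ Suc t * perm_avg X (\<lambda>\<sigma>. \<phi> (act \<sigma> (f (Suc t)))) - Suc t * \<eta> \<le>
    measure_pmf.expectation (step_dist walk (Suc t) (f 0)) \<phi>"
    using f t \<tau> supports_image[OF y msupp(1)[OF y] \<tau>(1)] \<phi>
    by (intro disjoint_support_bound[of t f "\<tau> ` msupp y"]) auto
  moreover have "perm_avg X (\<lambda>\<sigma>. \<phi> (act \<sigma> (act \<tau> y))) = perm_avg X (\<lambda>\<sigma>. \<phi> (act (\<sigma> \<circ> \<tau>) y))"
    using y \<tau>(1) by (intro perm_avg_cong) (simp add: act_comp)
  moreover have "\<dots> = perm_avg X (\<lambda>\<sigma>. \<phi> (act \<sigma> y))"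
    unfolding perm_avg_def using sum_permutations_compose_right[OF \<tau>(1), of "\<lambda>\<sigma>. \<phi> (act \<sigma> y)"] by simp
  ultimately show ?thesis
    using f(1,2) by (simp flip: t)
qed

text \<open>\<open>minorization\<close> is applied from \<open>y\<close> to \<open>\<phi>\<close>
  and from \<open>x\<close> to \<open>1 - \<phi>\<close>, both with target \<open>y\<close>; on
  adding, the averages over the orbit cancel and \<open>1 - c ^ (2 * R) + 4 * R * \<eta>\<close>
  remains.\<close>

sublocale contracting_chain V walk "2 * R" "c ^ (2 * R) / 2"
proof
  have c: "0 < c" "c \<le> 1" using c_bounds R_pos by auto
  then show "0 < c ^ (2 * R) / 2" by simp
  show "c ^ (2 * R) / 2 < 1" using c power_le_one[of c "2 * R"] by simp
  fix \<phi> :: "'b \<Rightarrow> real" and x y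
  assume \<phi>: "\<And>z. 0 \<le> \<phi> z" "\<And>z. \<phi> z \<le> 1" and xy: "x \<in> V" "y \<in> V"
  let ?E = "\<lambda>x. measure_pmf.expectation (step_dist walk (2 * R) x)"
  have "?E x (\<lambda>z. 1 - \<phi> z) = 1 - ?E x \<phi>"
    using sum_pmf_S[OF set_step_dist[OF xy(1)]]
    by (simp add: expectation_eq_sum set_step_dist xy right_diff_distrib sum_subtractf)
  moreover have "perm_avg X (\<lambda>\<sigma>. 1 - \<phi> (act \<sigma> y)) = 1 - perm_avg X (\<lambda>\<sigma>. \<phi> (act \<sigma> y))"
    by (simp add: perm_avg_diff perm_avg_const finite_X)
  ultimately have "c ^ (2 * R) - c ^ (2 * R) * perm_avg X (\<lambda>\<sigma>. \<phi> (act \<sigma> y)) - 2 * R * \<eta> \<le> 1 - ?E x \<phi>"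
    using minorization[OF xy(1,2), of "\<lambda>z. 1 - \<phi> z"] \<phi> by (simp add: right_diff_distrib)
  with minorization[OF xy(2,2), of \<phi>] \<phi> very_large
  show "?E x \<phi> - ?E y \<phi> \<le> 1 - c ^ (2 * R) / 2"
    by simp
qed

end

section \<open>FI-graphs\<close>

text \<open>The coincidence condition makes the map sending \<open>f i\<close> to
  \<open>f' i\<close> and \<open>g i\<close> to \<open>g' i\<close> well defined and injective, so
  it extends.\<close>

lemma extend_pair_to_permutation:
  assumes X: "finite X" and inj: "inj_on f A" "inj_on g A" "inj_on f' A" "inj_on g' A"
    and sub: "f ` A \<subseteq> X" "g ` A \<subseteq> X" "f' ` A \<subseteq> X" "g' ` A \<subseteq> X"
    and eq: "\<And>i j. i \<in> A \<Longrightarrow> j \<in> A \<Longrightarrow> f i = g j \<longleftrightarrow> f' i = g' j"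
  obtains \<sigma> where "\<sigma> permutes X" "\<And>i. i \<in> A \<Longrightarrow> \<sigma> (f i) = f' i" "\<And>i. i \<in> A \<Longrightarrow> \<sigma> (g i) = g' i"
proof -
  define h where "h x = (if x \<in> f ` A then f' (inv_into A f x) else g' (inv_into A g x))" for x
  have hf: "h (f i) = f' i" if "i \<in> A" for i
    using that inj(1) by (simp add: h_def)
  have hg: "h (g i) = g' i" if i: "i \<in> A" for i
  proof (cases "g i \<in> f ` A")
    case True
    then obtain j where j: "j \<in> A" "g i = f j" by auto
    then have "f' j = g' i" using eq[OF j(1) i] by metis
    then show ?thesis using hf[OF j(1)] j(2) by simp
  next
    case False
    then show ?thesis using i inj(2) by (simp add: h_def)
  qed
  have h: "inj_on h (f ` A \<union> g ` A)"
  proof (rule inj_onI)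
    fix x y assume "x \<in> f ` A \<union> g ` A" "y \<in> f ` A \<union> g ` A" and hxy: "h x = h y"
    then obtain i j where ij: "i \<in> A" "j \<in> A" "x = f i \<or> x = g i" "y = f j \<or> y = g j" by blast
    then consider "x = f i" "y = f j" | "x = f i" "y = g j" | "x = g i" "y = f j" | "x = g i" "y = g j"
      by blast
    then show "x = y"
    proof cases
      case 1
      then show ?thesis using hxy hf ij(1,2) inj_onD[OF inj(3)] by metis
    next
      case 2
      then show ?thesis using hxy hf[OF ij(1)] hg[OF ij(2)] eq[OF ij(1,2)] by simp
    next
      case 3
      then show ?thesis using hxy hf[OF ij(2)] hg[OF ij(1)] eq[OF ij(2,1)] by simp
    next
      case 4
      then show ?thesis using hxy hg ij(1,2) inj_onD[OF inj(4)] by metis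
    qed
  qed
  have hX: "h ` (f ` A \<union> g ` A) \<subseteq> X"
  proof clarify
    fix x assume "x \<in> f ` A \<union> g ` A"
    then obtain i where "i \<in> A" "x = f i \<or> x = g i" by blast
    then show "h x \<in> X" using hf hg sub(3,4) by blast
  qed
  have "f ` A \<union> g ` A \<subseteq> X" using sub by blast
  from extend_to_permutation[OF X this h hX] obtain \<sigma> where \<sigma>: "\<sigma> permutes X" "\<And>x. x \<in> f ` A \<union> g ` A \<Longrightarrow> \<sigma> x = h x"
    by blast
  show thesis
    by (rule that[OF \<sigma>(1)]) (simp_all add: \<sigma>(2) hf hg)
qed

section \<open>Injections of FI and permutations\<close>

lemma FI_homD:
  assumes "f \<in> FI_hom m n"
  shows "inj_on f {1..m}" "f ` {1..m} \<subseteq> {1..n}" "f \<in> extensional {1..m}"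
  using assms by (auto simp: FI_hom_def PiE_def)

lemma FI_hom_compose:
  assumes "f \<in> FI_hom l m" "g \<in> FI_hom m n"
  shows "compose {1..l} g f \<in> FI_hom l n"
proof -
  note f = FI_homD[OF assms(1)] and g = FI_homD[OF assms(2)]
  have "inj_on (g \<circ> f) {1..l}"
    using f g by (intro comp_inj_on) (auto intro: inj_on_subset)
  then have "inj_on (compose {1..l} g f) {1..l}"
    by (rule inj_on_cong[THEN iffD1, rotated]) (simp add: compose_def)
  then show ?thesis
    using f g by (auto simp: FI_hom_def compose_def PiE_def Pi_def image_subset_iff)
qed

lemma FI_hom_permutation: "\<sigma> permutes {1..n} \<Longrightarrow> restrict \<sigma> {1..n} \<in> FI_hom n n"
  using permutes_in_image[of \<sigma> "{1..n}"] permutes_inj_on[of \<sigma> "{1..n}"]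
  by (auto simp: FI_hom_def simp del: atLeastAtMost_iff)

lemma FI_hom_self: "FI_hom n n = (\<lambda>\<sigma>. restrict \<sigma> {1..n}) ` {\<sigma>. \<sigma> permutes {1..n}}"
proof
  show "FI_hom n n \<subseteq> (\<lambda>\<sigma>. restrict \<sigma> {1..n}) ` {\<sigma>. \<sigma> permutes {1..n}}"
  proof
    fix f assume "f \<in> FI_hom n n"
    note f = FI_homD[OF this]
    obtain \<sigma> where \<sigma>: "\<sigma> permutes {1..n}" "\<And>i. i \<in> {1..n} \<Longrightarrow> \<sigma> i = f i"
      using extend_to_permutation[OF _ order_refl f(1,2)] by auto
    have "f = restrict \<sigma> {1..n}"
      using f(3) \<sigma>(2) by (intro extensionalityI[of f "{1..n}"]) auto
    with \<sigma>(1) show "f \<in> (\<lambda>\<sigma>. restrict \<sigma> {1..n}) ` {\<sigma>. \<sigma> permutes {1..n}}" by blast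
  qed
qed (use FI_hom_permutation in blast)

section \<open>The symmetric group action on an FI-graph\<close>

context FI_graph
begin

definition act :: "nat \<Rightarrow> (nat \<Rightarrow> nat) \<Rightarrow> 'v \<Rightarrow> 'v" where
  "act n \<sigma> = F n n (restrict \<sigma> {1..n})"

lemma map_in: "f \<in> FI_hom m n \<Longrightarrow> v \<in> V m \<Longrightarrow> F m n f v \<in> V n"
  using hom by (auto simp: graph_hom_def)

lemma act_map:
  assumes "\<sigma> permutes {1..n}" "f \<in> FI_hom m n" "v \<in> V m"
  shows "act n \<sigma> (F m n f v) = F m n (restrict (\<sigma> \<circ> f) {1..m}) v"
proof -
  have "compose {1..m} (restrict \<sigma> {1..n}) f = restrict (\<sigma> \<circ> f) {1..m}"
    using FI_homD(2)[OF assms(2)] by (auto simp: compose_def restrict_def image_subset_iff)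
  then show ?thesis
    using map_compose[OF assms(2) FI_hom_permutation[OF assms(1)] assms(3)] by (simp add: act_def)
qed

lemma act_act:
  assumes "\<sigma> permutes {1..n}" "\<tau> permutes {1..n}" "v \<in> V n"
  shows "act n (\<sigma> \<circ> \<tau>) v = act n \<sigma> (act n \<tau> v)"
proof -
  have "restrict (\<sigma> \<circ> restrict \<tau> {1..n}) {1..n} = restrict (\<sigma> \<circ> \<tau>) {1..n}"
    by (auto simp: restrict_def)
  then show ?thesis
    using act_map[OF assms(1) FI_hom_permutation[OF assms(2)] assms(3)]
    by (simp add: act_def[of n \<tau>] act_def[of n "\<sigma> \<circ> \<tau>"])
qed

lemma generated:
  assumes gen: "\<forall>n\<ge>d. \<forall>v\<in>V (n + 1). \<exists>f\<in>FI_hom n (n + 1). v \<in> F n (n + 1) f ` V n"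
    and "d \<le> n" "v \<in> V n"
  shows "\<exists>u\<in>V d. \<exists>f\<in>FI_hom d n. v = F d n f u"
  using assms(2,3)
proof (induction n arbitrary: v rule: dec_induct)
  case base
  have "restrict id {1..d} \<in> FI_hom d d" by (auto simp: FI_hom_def)
  then show ?case using base map_id by metis
next
  case (step n)
  have "\<exists>f\<in>FI_hom n (Suc n). v \<in> F n (Suc n) f ` V n"
    using gen step.hyps(1) step.prems by simp
  then obtain g w where g: "g \<in> FI_hom n (Suc n)" "w \<in> V n" "v = F n (Suc n) g w"
    by (elim bexE imageE)
  obtain u f where u: "u \<in> V d" "f \<in> FI_hom d n" "w = F d n f u"
    using step.IH[OF g(2)] by blast
  have "v = F d (Suc n) (compose {1..d} g f) u"
    using map_compose[OF u(2) g(1) u(1)] g u by simp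
  then show ?case using u(1) FI_hom_compose[OF u(2) g(1)] by blast
qed

text \<open>Each vertex is the image of a source \<open>s v\<close> in degree \<open>d\<close> under
  an injection \<open>f v\<close>, and permutations fixing the range of \<open>f v\<close> on
  \<open>{1..d}\<close> fix \<open>v\<close>. Pairs of vertices with the same sources and the same
  coincidences between their injections are related by a permutation; \<open>R\<close> counts the
  possible patterns.\<close>

lemma perm_graph:
  assumes gen: "\<forall>n\<ge>d. \<forall>v\<in>V (n + 1). \<exists>f\<in>FI_hom n (n + 1). v \<in> F n (n + 1) f ` V n"
    and R: "R = card (V d \<times> V d \<times> Pow ({1..d} \<times> {1..d}))"
    and n: "d < n" "2 * d\<^sup>2 < n - d"
  shows "\<exists>ptype. perm_graph {1..n} (V n) (E n) (act n) d R ptype"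
proof -
  have "\<exists>u f. u \<in> V d \<and> f \<in> FI_hom d n \<and> v = F d n f u" if "v \<in> V n" for v
    using generated[OF gen less_imp_le[OF n(1)] that] by blast
  then obtain s f where s: "\<And>v. v \<in> V n \<Longrightarrow> s v \<in> V d"
    and f: "\<And>v. v \<in> V n \<Longrightarrow> f v \<in> FI_hom d n"
    and sf: "\<And>v. v \<in> V n \<Longrightarrow> v = F d n (f v) (s v)" by metis
  let ?C = "V d \<times> V d \<times> Pow ({1..d} \<times> {1..d})"
  have "finite ?C" using graph[of d] by (simp add: finite_graph_def)
  then obtain code where code: "bij_betw code ?C {0..<R}"
    unfolding R using ex_bij_betw_finite_nat by blast
  define pat where "pat v w = (s v, s w, {(i, j) \<in> {1..d} \<times> {1..d}. f v i = f w j})" for v w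
  have pat: "pat v w \<in> ?C" if "v \<in> V n" "w \<in> V n" for v w
    using s that by (auto simp: pat_def)
  have "perm_graph {1..n} (V n) (E n) (act n) d R (\<lambda>(v, w). code (pat v w))"
  proof
    fix \<sigma> v assume "\<sigma> permutes {1..n}" "v \<in> V n"
    then show "act n \<sigma> v \<in> V n" unfolding act_def by (intro map_in FI_hom_permutation)
  next
    fix \<sigma> e assume "\<sigma> permutes {1..n}" "e \<in> E n"
    then show "act n \<sigma> ` e \<in> E n"
      using hom[OF FI_hom_permutation] by (auto simp: act_def graph_hom_def)
  next
    fix v assume v: "v \<in> V n"
    note fv = FI_homD[OF f[OF v]]
    show "\<exists>A\<subseteq>{1..n}. card A \<le> d \<and> (\<forall>\<sigma>. \<sigma> permutes {1..n} - A \<longrightarrow> act n \<sigma> v = v)"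
    proof (intro exI[of _ "f v ` {1..d}"] conjI allI impI fv(2))
      show "card (f v ` {1..d}) \<le> d" using card_image_le[of "{1..d}" "f v"] by simp
      fix \<sigma> assume \<sigma>: "\<sigma> permutes {1..n} - f v ` {1..d}"
      have "restrict (\<sigma> \<circ> f v) {1..d} = f v"
        using fv(3) permutes_not_in[OF \<sigma>] by (intro extensionalityI[of _ "{1..d}"]) auto
      moreover have "\<sigma> permutes {1..n}" using \<sigma> by (rule permutes_subset) auto
      ultimately show "act n \<sigma> v = v"
        using act_map[OF _ f[OF v] s[OF v], of \<sigma>] sf[OF v] by simp
    qed
  next
    fix p assume "p \<in> V n \<times> V n"
    then obtain v w where vw: "p = (v, w)" "v \<in> V n" "w \<in> V n" by auto
    have "code (pat v w) \<in> {0..<R}"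
      by (rule bspec[OF bij_betwE[OF code] pat[OF vw(2,3)]])
    then show "(\<lambda>(v, w). code (pat v w)) p < R" by (simp add: vw(1))
  next
    fix v w v' w'
    assume vw: "(v, w) \<in> V n \<times> V n" "(v', w') \<in> V n \<times> V n"
      and eq: "(\<lambda>(v, w). code (pat v w)) (v, w) = (\<lambda>(v, w). code (pat v w)) (v', w')"
    have V: "v \<in> V n" "w \<in> V n" "v' \<in> V n" "w' \<in> V n" using vw by auto
    have "pat v w = pat v' w'"
      using eq inj_onD[OF bij_betw_imp_inj_on[OF code]] pat V by simp
    then have src: "s v = s v'" "s w = s w'"
      and coinc: "{(i, j) \<in> {1..d} \<times> {1..d}. f v i = f w j} = {(i, j) \<in> {1..d} \<times> {1..d}. f v' i = f w' j}"
      by (simp_all only: pat_def prod.inject)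
    have iff: "f v i = f w j \<longleftrightarrow> f v' i = f w' j" if "i \<in> {1..d}" "j \<in> {1..d}" for i j
      using coinc that by blast
    note H = FI_homD[OF f[OF V(1)]] FI_homD[OF f[OF V(2)]] FI_homD[OF f[OF V(3)]] FI_homD[OF f[OF V(4)]]
    obtain \<sigma> where \<sigma>: "\<sigma> permutes {1..n}" "\<And>i. i \<in> {1..d} \<Longrightarrow> \<sigma> (f v i) = f v' i"
      "\<And>i. i \<in> {1..d} \<Longrightarrow> \<sigma> (f w i) = f w' i"
      using extend_pair_to_permutation[OF finite_atLeastAtMost H(1,4,7,10) H(2,5,8,11) iff] by blast
    have "restrict (\<sigma> \<circ> f v) {1..d} = f v'" "restrict (\<sigma> \<circ> f w) {1..d} = f w'"
      using \<sigma>(2,3) H(9,12) by (auto intro!: extensionalityI[of _ "{1..d}"])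
    then have "act n \<sigma> v = v'" "act n \<sigma> w = w'"
      using act_map[OF \<sigma>(1) f[OF V(1)] s[OF V(1)]] act_map[OF \<sigma>(1) f[OF V(2)] s[OF V(2)]]
        sf[OF V(1)] sf[OF V(2)] sf[OF V(3)] sf[OF V(4)] src by simp_all
    with \<sigma>(1) show "\<exists>\<sigma>. \<sigma> permutes {1..n} \<and> act n \<sigma> v = v' \<and> act n \<sigma> w = w'" by blast
  qed (use graph n act_act map_id in \<open>auto simp: act_def\<close>)
  then show ?thesis by blast
qed

lemma walk_eq:
  assumes "perm_graph {1..n} (V n) (E n) (act n) d R ptype"
  shows "perm_graph.walk {1..n} (E n) (act n) = weighted_walk E F n"
proof -
  interpret perm_graph "{1..n}" "V n" "E n" "act n" d R ptype by fact
  have *: "orbit ` E n = edge_orbits E F n"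
    unfolding edge_orbits_def FI_hom_self orbit_def[abs_def] act_def image_image ..
  show ?thesis unfolding walk_def[abs_def] weighted_walk_def[abs_def] * ..
qed

end

theorem theorem3p15:
  fixes V :: "nat \<Rightarrow> 'v set"
    and E :: "nat \<Rightarrow> 'v set set"
    and F :: "nat \<Rightarrow> nat \<Rightarrow> (nat \<Rightarrow> nat) \<Rightarrow> 'v \<Rightarrow> 'v"
  assumes "FI_graph V E F"
    and "finitely_generated V F"
    and "\<forall>n. graph_connected (V n) (E n)"
    and "\<exists>N. \<forall>n\<ge>N. \<not> graph_bipartite (V n) (E n)"
  shows "\<forall>\<epsilon>>0. \<exists>T N. \<forall>n>N. mixing_time (V n) (weighted_walk E F n) \<epsilon> \<le> enat T"
proof (intro allI impI)
  fix \<epsilon> :: real assume \<epsilon>: "0 < \<epsilon>"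
  interpret FI_graph V E F by fact
  obtain d where d: "\<forall>n\<ge>d. \<forall>v\<in>V (n + 1). \<exists>f\<in>FI_hom n (n + 1). v \<in> F n (n + 1) f ` V n"
    using assms(2) by (auto simp: finitely_generated_def)
  obtain N0 where N0: "\<And>n. n \<ge> N0 \<Longrightarrow> \<not> graph_bipartite (V n) (E n)"
    using assms(4) by blast
  define R where "R = card (V d \<times> V d \<times> Pow ({1..d} \<times> {1..d}))"
  \<comment> \<open>\<open>k\<close> is the value of \<open>c\<close>; it depends on
    \<open>d\<close> and \<open>R\<close> only, so the number \<open>m\<close> of blocks of steps
    can be chosen before \<open>n\<close>.\<close>
  define k :: real where "k = 1 / (2 * R * d ^ d)"
  \<comment> \<open>For \<open>R = 0\<close> division by zero gives \<open>k = 0\<close>, but the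
    exponent is 0 and the power is 1.\<close>
  have "0 < k ^ (2 * R)"
  proof (cases "R = 0")
    case False
    have "0 < d ^ d" by (cases "d = 0") auto
    then have "0 < k" using False unfolding k_def by (intro divide_pos_pos) (auto simp del: of_nat_power)
    then show ?thesis by simp
  qed simp
  then obtain m where m: "(1 - k ^ (2 * R) / 2) ^ m < \<epsilon>"
    using real_arch_pow_inv[OF \<epsilon>, of "1 - k ^ (2 * R) / 2"] by auto
  \<comment> \<open>Once \<open>n - d\<close> is at least \<open>B\<close>, the error satisfies
    \<open>8 * R * \<eta> \<le> k ^ (2 * R)\<close>.\<close>
  define B where "B = nat \<lceil>8 * R * (real d)\<^sup>2 / k ^ (2 * R)\<rceil>"
  have B: "8 * R * (real d)\<^sup>2 \<le> k ^ (2 * R) * B"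
  proof -
    have "8 * R * (real d)\<^sup>2 / k ^ (2 * R) \<le> B" unfolding B_def by linarith
    then show ?thesis using \<open>0 < k ^ (2 * R)\<close> by (simp add: divide_le_eq mult.commute)
  qed
  \<comment> \<open>The summands of the threshold secure, in turn, that \<open>G_n\<close> is not
    bipartite, the size conditions of \<open>perm_graph\<close>, and
    \<open>very_large\<close>.\<close>
  have "mixing_time (V n) (weighted_walk E F n) \<epsilon> \<le> enat (m * (2 * R))"
    if n: "n > N0 + d + 2 * d\<^sup>2 + B" for n
  proof -
    have n_large: "d < n" "2 * d\<^sup>2 < n - d" "B \<le> n - d" using n by linarith+
    obtain ptype where ptype: "perm_graph {1..n} (V n) (E n) (act n) d R ptype"
      using perm_graph[OF d R_def n_large(1,2)] by blast
    then interpret perm_graph "{1..n}" "V n" "E n" "act n" d R ptype .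
    have ceq: "c = k" unfolding c_def k_def ..
    have "mixing_perm_graph {1..n} (V n) (E n) (act n) d R ptype"
    proof
      show "graph_connected (V n) (E n)" using assms(3) by blast
      show "\<not> graph_bipartite (V n) (E n)" using N0 n by simp
      have "8 * R * (real d)\<^sup>2 \<le> k ^ (2 * R) * real (n - d)"
        using B n_large(3) \<open>0 < k ^ (2 * R)\<close>
        by (elim order_trans) (intro mult_left_mono, auto)
      then show "8 * R * \<eta> \<le> c ^ (2 * R)"
        using n_large(1) unfolding ceq \<eta>_def by (simp add: divide_le_eq)
    qed
    then interpret mixing_perm_graph "{1..n}" "V n" "E n" "act n" d R ptype .
    show ?thesis
      using mixing_time_le[of m \<epsilon>] m unfolding ceq walk_eq[OF ptype] by simp
  qed
  then show "\<exists>T N. \<forall>n>N. mixing_time (V n) (weighted_walk E F n) \<epsilon> \<le> enat T" by blast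
qed

end
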